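(* Let $S\subset\mathbb{R}^k$ be a halfspace and $\Sigma\subseteq\mathbb{R}^k$ an additive subgroup. Let $G\in(AP^k_\Sigma)^{m\times n}$ with $m<n$ (respectively, $m>n$), and let $p=\max\{m,n\}$. Then $G$ is $(AP_S)_\Sigma$-factorable with indices $\lambda_1,\dots,\lambda_p$ if and only if $G$ can be augmented by $n-m$ rows (respectively, by $m-n$ columns) to a square ($p\times p$) $(AP_S)_\Sigma$-factorable matrix function with the same indices. In particular, $G$ admits a canonical $(AP_S)_\Sigma$-factorization if and only if $G$ can be augmented to a square size matrix function (in the same sense) that admits a canonical $(AP_S)_\Sigma$-factorization.
   Context: $AP^k$ is the algebra of complex valued almost periodic functions of $k$ real variables: the closed subalgebra of $L^\infty(\mathbb{R}^k)$ generated by the functions $e_\lambda(x)=e^{i\langle\lambda,x\rangle}$, $\lambda\in\mathbb{R}^k$. For $f\in AP^k$, $f_\lambda=\lim_{T\to\infty}\frac{1}{(2T)^k}\int_{[-T,T]^k}e^{-i\langle\lambda,x\rangle}f(x)\,dx$ and $\sigma(f)=\{\lambda\in\mathbb{R}^k:f_\lambda\ne0\}$ is its Bohr-Fourier spectrum. For nonempty $\Delta\subseteq\mathbb{R}^k$, $AP^k_\Delta=\{f\in AP^k:\sigma(f)\subseteq\Delta\}$. $(X)^{m\times n}$ denotes the set of $m\times n$ matrices with entries in $X$. A subset $S\subset\mathbb{R}^k$ is a halfspace if (i) $\mathbb{R}^k=S\cup(-S)$; (ii) $S\cap(-S)=\{0\}$; (iii) $\lambda,\mu\in S$ implies $\lambda+\mu\in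 S$; (iv) $\lambda\in S$ and $\alpha\ge 0$ real imply $\alpha\lambda\in S$. For $G\in(AP^k_\Sigma)^{m\times n}$, a (left) $(AP_S)_\Sigma$ factorization of $G$ is a representation $$G=G^+\,\mathrm{diag}(e_{\lambda_1},\dots,e_{\lambda_p})\,G^-,\qquad p=\max\{m,n\},$$ where $G^+\in(AP^k_{\Sigma\cap S})^{m\times p}$ has a right inverse in $(AP^k_{\Sigma\cap S})^{p\times m}$, $G^-\in(AP^k_{\Sigma\cap(-S)})^{p\times n}$ has a left inverse in $(AP^k_{\Sigma\cap(-S)})^{n\times p}$, and $\lambda_1,\dots,\lambda_p\in\Sigma$. The $\lambda_j$ are called the factorization indices and are assumed to be ordered so that $\lambda_j-\lambda_{j-1}\in S$ for $j=2,\dots,p$. $G$ is $(AP_S)_\Sigma$-factorable if it admits such a factorization. The factorization is canonical if all factorization indices are zero (i.e. the middle factor is $I_p$). The same definition applies to square matrix functions ($m=n=p$). "Augmented by rows (columns)" means that additional rows (columns), with entries in $AP^k_\Sigma$, are adjoined to $G$. *)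

theory Defs
  imports
    "HOL-Analysis.Analysis"
    "HOL-Library.Function_Algebras"
    "Jordan_Normal_Form.Matrix"
begin

text \<open>
  Matrix functions are matrices over the ring of functions with pointwise operations
  (\<open>Function_Algebras\<close>), so matrix products and identity matrices are the library's own.
\<close>

definition e_fun :: "real ^ 'k \<Rightarrow> real ^ 'k \<Rightarrow> complex" where
  "e_fun l = (\<lambda>x. exp (\<i> * complex_of_real (inner l x)))"

text \<open>
  The smallest subalgebra that is closed in the supremum norm and contains all exponentials.
  Every class in the corresponding closed subalgebra of \<open>L\<^sup>\<infinity>\<close> has exactly one continuous
  representative, and on continuous functions the essential supremum is the supremum; the set
  below consists of these representatives.
\<close>

inductive_set AP :: "(real ^ 'k \<Rightarrow> complex) set" where
  AP_e: "e_fun l \<in> AP"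
| AP_add: "f \<in> AP \<Longrightarrow> g \<in> AP \<Longrightarrow> f + g \<in> AP"
| AP_scale: "f \<in> AP \<Longrightarrow> (\<lambda>x. c * f x) \<in> AP"
| AP_mult: "f \<in> AP \<Longrightarrow> g \<in> AP \<Longrightarrow> f * g \<in> AP"
| AP_closed: "(\<And>n::nat. F n \<in> AP) \<Longrightarrow> uniform_limit UNIV F f sequentially \<Longrightarrow> f \<in> AP"

definition bohr_coeff :: "(real ^ 'k \<Rightarrow> complex) \<Rightarrow> real ^ 'k \<Rightarrow> complex" where
  "bohr_coeff f l = Lim at_top (\<lambda>T::real.
     1 / complex_of_real ((2 * T) ^ CARD('k)) *
     integral (cbox (\<chi> i. - T) (\<chi> i. T))
       (\<lambda>x. exp (- \<i> * complex_of_real (inner l x)) * f x))"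

definition bohr_spectrum :: "(real ^ 'k \<Rightarrow> complex) \<Rightarrow> (real ^ 'k) set" where
  "bohr_spectrum f = {l. bohr_coeff f l \<noteq> 0}"

definition AP_on :: "(real ^ 'k) set \<Rightarrow> (real ^ 'k \<Rightarrow> complex) set" where
  "AP_on D = {f \<in> AP. bohr_spectrum f \<subseteq> D}"

definition AP_mat :: "(real ^ 'k) set \<Rightarrow> nat \<Rightarrow> nat \<Rightarrow> (real ^ 'k \<Rightarrow> complex) mat set" where
  "AP_mat D m n = {A \<in> carrier_mat m n. elements_mat A \<subseteq> AP_on D}"

definition halfspace :: "(real ^ 'k) set \<Rightarrow> bool" where
  "halfspace S \<longleftrightarrow>
     UNIV = S \<union> uminus ` S \<and>
     S \<inter> uminus ` S = {0} \<and>
     (\<forall>l\<in>S. \<forall>u\<in>S. l + u \<in> S) \<and>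
     (\<forall>l\<in>S. \<forall>a::real. a \<ge> 0 \<longrightarrow> a *\<^sub>R l \<in> S)"

definition add_subgroup :: "(real ^ 'k) set \<Rightarrow> bool" where
  "add_subgroup H \<longleftrightarrow>
     0 \<in> H \<and> (\<forall>x\<in>H. \<forall>y\<in>H. x + y \<in> H) \<and> (\<forall>x\<in>H. - x \<in> H)"

text \<open>The list \<open>ls\<close> holds the factorization indices; its entry \<open>ls ! j\<close> is the (\<open>j + 1\<close>)-st index.\<close>

definition is_AP_factorization ::
  "(real ^ 'k) set \<Rightarrow> (real ^ 'k) set \<Rightarrow> nat \<Rightarrow> nat \<Rightarrow> (real ^ 'k \<Rightarrow> complex) mat
   \<Rightarrow> (real ^ 'k \<Rightarrow> complex) mat \<Rightarrow> (real ^ 'k) list \<Rightarrow> (real ^ 'k \<Rightarrow> complex) mat \<Rightarrow> bool" where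
  "is_AP_factorization S \<Sigma> m n G Gp ls Gm \<longleftrightarrow>
     (let p = max m n; Sp = \<Sigma> \<inter> S; Sm = \<Sigma> \<inter> uminus ` S in
       Gp \<in> AP_mat Sp m p \<and> (\<exists>R \<in> AP_mat Sp p m. Gp * R = 1\<^sub>m m) \<and>
       Gm \<in> AP_mat Sm p n \<and> (\<exists>L \<in> AP_mat Sm n p. L * Gm = 1\<^sub>m n) \<and>
       length ls = p \<and> set ls \<subseteq> \<Sigma> \<and>
       (\<forall>j. 1 \<le> j \<and> j < p \<longrightarrow> ls ! j - ls ! (j - 1) \<in> S) \<and>
       G = Gp * mat_diag p (\<lambda>j. e_fun (ls ! j)) * Gm)"

definition AP_factorable_with ::
  "(real ^ 'k) set \<Rightarrow> (real ^ 'k) set \<Rightarrow> nat \<Rightarrow> nat \<Rightarrow> (real ^ 'k \<Rightarrow> complex) mat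
   \<Rightarrow> (real ^ 'k) list \<Rightarrow> bool" where
  "AP_factorable_with S \<Sigma> m n G ls \<longleftrightarrow> (\<exists>Gp Gm. is_AP_factorization S \<Sigma> m n G Gp ls Gm)"

definition canonically_AP_factorable ::
  "(real ^ 'k) set \<Rightarrow> (real ^ 'k) set \<Rightarrow> nat \<Rightarrow> nat \<Rightarrow> (real ^ 'k \<Rightarrow> complex) mat \<Rightarrow> bool" where
  "canonically_AP_factorable S \<Sigma> m n G \<longleftrightarrow>
     (\<exists>ls. AP_factorable_with S \<Sigma> m n G ls \<and> (\<forall>l \<in> set ls. l = 0))"

text \<open>Column counterpart of the library's \<open>append_rows\<close>.\<close>

definition append_cols :: "'a :: zero mat \<Rightarrow> 'a mat \<Rightarrow> 'a mat" where
  "append_cols A B = four_block_mat A B (0\<^sub>m 0 (dim_col A)) (0\<^sub>m 0 (dim_col B))"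

end

theory Submission
  imports
    Defs
    "HOL-Complex_Analysis.Conformal_Mappings"
    "HOL-Real_Asymp.Real_Asymp"
    "Jordan_Normal_Form.Determinant"
begin

text \<open>
  Let \<open>m < n\<close>. If an augmented matrix \<open>G @\<^sub>r H\<close> factors as \<open>Gp * D * Gm\<close>, then the first \<open>m\<close> rows of
  \<open>Gp\<close>, together with the same \<open>D\<close> and \<open>Gm\<close>, factor \<open>G\<close>. Conversely, if \<open>G = Gp * D * Gm\<close>, it suffices
  to adjoin rows \<open>C\<close> to the right invertible \<open>Gp\<close> so that the square matrix becomes invertible over the
  same algebra: then \<open>H = C * D * Gm\<close> works. So the theorem says that over the algebra of functions with
  spectrum in \<open>\<Sigma> \<inter> S\<close> every right invertible matrix can be completed to an invertible one
  (\<open>right_invertible_completable\<close>). The case \<open>m > n\<close> follows by transposition, which exchanges \<open>S\<close> and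
  \<open>- S\<close>.

  The completion is a homotopy argument. If \<open>B * R = 1\<close> and \<open>B'\<close> is uniformly close to \<open>B\<close>, then
  \<open>B' = B * (1 + R * (B' - B))\<close>, where the second factor is invertible over the algebra
  (\<open>col_equiv_near\<close>); and completability is preserved by right multiplication with invertible matrices.
  Hence completability is constant along norm continuous paths of right invertible matrices. First \<open>B\<close>
  is moved to a matrix of trigonometric polynomials. Only finitely many nonzero exponents occur in that
  matrix and in an approximate right inverse; they lie in the pointed convex cone \<open>S\<close>, so some linear
  functional \<open>inner w\<close> is positive on all of them (\<open>halfspace_positive_functional\<close>). Replacing each
  \<open>e_fun l\<close> by \<open>r powr (inner w l) * e_fun l\<close> and letting \<open>r\<close> run from \<open>1\<close> to \<open>0\<close> deforms the matrix to
  a constant one. This substitution is the analytic continuation \<open>x \<mapsto> x - \<i> ln r w\<close>, hence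
  multiplicative, and by the maximum principle in a half plane it does not enlarge the distance of the
  product from the identity (\<open>dilate_product_sum_bound\<close>). So right invertibility persists down to
  \<open>r = 0\<close>, where linear algebra over \<open>\<complex>\<close> completes the matrix.

  What the argument needs about almost periodic functions is that a function with spectrum in \<open>D\<close> is a
  uniform limit of trigonometric polynomials with exponents in \<open>D\<close> (\<open>AP_on_trig_approx\<close>); for a
  submonoid \<open>D\<close> it also follows that these functions form an algebra. The approximants are means of the
  function against the nonnegative kernels \<open>\<bar>\<Sum>v\<in>V. e_fun v\<bar>\<^sup>2 / card V\<close>, where \<open>V\<close> is a finite set of
  frequencies that is almost invariant under the given finitely many translations
  (\<open>exists_Folner_set\<close>).
\<close>

section \<open>Exponentials and almost periodic functions\<close>

lemma e_fun_zero: "e_fun 0 = (\<lambda>x. 1)"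
  by (simp add: e_fun_def)

lemma e_fun_add: "e_fun (l + m) x = e_fun l x * e_fun m x"
  by (simp add: e_fun_def inner_add_left exp_add[symmetric] distrib_left)

lemma e_fun_shift: "e_fun l (x + h) = e_fun l x * e_fun l h"
  by (simp add: e_fun_def inner_add_right exp_add[symmetric] distrib_left)

lemma norm_e_fun [simp]: "cmod (e_fun l x) = 1"
  by (simp add: e_fun_def)

lemma e_fun_uminus: "e_fun (- l) x = cnj (e_fun l x)"
  by (simp add: e_fun_def exp_cnj)

lemma e_fun_uminus_right: "e_fun l (- x) = cnj (e_fun l x)"
  by (simp add: e_fun_def exp_cnj)

lemma continuous_on_e_fun [continuous_intros]: "continuous_on A (e_fun l)"
  unfolding e_fun_def by (intro continuous_intros)

lemma AP_const: "(\<lambda>x. c) \<in> AP"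
  using AP_scale[OF AP_e[of 0], of c] by (simp add: e_fun_zero)

lemma AP_continuous: "f \<in> AP \<Longrightarrow> continuous_on A f"
proof -
  have "f \<in> AP \<Longrightarrow> continuous_on UNIV f"
  proof (induction rule: AP.induct)
    case (AP_closed F f)
    show ?case by (rule uniform_limit_theorem[OF _ AP_closed.hyps(2)]) (auto intro!: always_eventually AP_closed)
  qed (auto intro!: continuous_intros simp: plus_fun_def times_fun_def)
  then show "f \<in> AP \<Longrightarrow> continuous_on A f" by (rule continuous_on_subset) auto
qed

lemma AP_bounded: "f \<in> AP \<Longrightarrow> \<exists>B>0. \<forall>x. cmod (f x) \<le> B"
proof (induction rule: AP.induct)
  case (AP_e l) then show ?case by (intro exI[of _ 1]) auto
next
  case (AP_add f g)
  then obtain B C where "B > 0" "C > 0" "\<And>x. cmod (f x) \<le> B" "\<And>x. cmod (g x) \<le> C" by blast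
  then show ?case by (intro exI[of _ "B + C"]) (auto intro!: norm_triangle_mono)
next
  case (AP_scale f c)
  then obtain B where "B > 0" "\<And>x. cmod (f x) \<le> B" by blast
  then show ?case
    by (intro exI[of _ "(cmod c + 1) * B"]) (auto simp: norm_mult intro!: mult_mono mult_pos_pos add_nonneg_pos)
next
  case (AP_mult f g)
  then obtain B C where "B > 0" "C > 0" "\<And>x. cmod (f x) \<le> B" "\<And>x. cmod (g x) \<le> C" by blast
  then show ?case by (intro exI[of _ "B * C"]) (auto simp: norm_mult intro!: mult_mono)
next
  case (AP_closed F f)
  from uniform_limitD[OF AP_closed.hyps(2), of 1] obtain n where n: "\<And>x. dist (F n x) (f x) < 1"
    by (auto simp: eventually_sequentially)
  obtain B where "B > 0" and B: "\<And>x. cmod (F n x) \<le> B" using AP_closed.IH by blast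
  have "cmod (f x) \<le> B + 1" for x
    using B[of x] n[of x] norm_triangle_ineq3[of "F n x" "f x"] by (simp add: dist_norm)
  then show ?case using \<open>B > 0\<close> by (intro exI[of _ "B + 1"]) auto
qed

section \<open>Means over cubes\<close>

abbreviation cube :: "real \<Rightarrow> (real ^ 'k) set" where
  "cube T \<equiv> cbox (\<chi> i. - T) (\<chi> i. T)"

definition cube_mean :: "(real ^ 'k \<Rightarrow> complex) \<Rightarrow> real \<Rightarrow> complex" where
  "cube_mean f T = 1 / complex_of_real ((2 * T) ^ CARD('k)) * integral (cube T) f"

definition has_mean :: "(real ^ 'k \<Rightarrow> complex) \<Rightarrow> complex \<Rightarrow> bool" where
  "has_mean f a \<longleftrightarrow> (cube_mean f \<longlongrightarrow> a) at_top"

lemma content_cube: "T \<ge> 0 \<Longrightarrow> measure lborel (cube T :: (real ^ 'k) set) = (2 * T) ^ CARD('k)"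
  by (subst content_cbox_cart) (auto simp: interval_ne_empty_cart)

lemma continuous_integrable_on_cbox:
  "continuous_on UNIV f \<Longrightarrow> (f :: real ^ 'k \<Rightarrow> 'a :: banach) integrable_on cbox a b"
  by (rule integrable_continuous) (rule continuous_on_subset, auto)

lemma has_mean_const: "has_mean (\<lambda>x :: real ^ 'k. c) c"
  unfolding has_mean_def
proof (rule tendsto_eventually, rule eventually_mono[OF eventually_gt_at_top[of 0]])
  fix T :: real assume T: "T > 0"
  then show "cube_mean (\<lambda>x :: real ^ 'k. c) T = c"
    by (simp add: cube_mean_def content_cube scaleR_conv_of_real)
qed

lemma has_mean_add:
  assumes "continuous_on UNIV f" "continuous_on UNIV g" "has_mean f a" "has_mean g b"
  shows "has_mean (\<lambda>x. f x + g x) (a + b)"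
proof -
  have "cube_mean (\<lambda>x. f x + g x) = (\<lambda>T. cube_mean f T + cube_mean g T)"
    using assms(1,2)
    by (simp add: cube_mean_def fun_eq_iff continuous_integrable_on_cbox integral_add add_divide_distrib)
  then show ?thesis using tendsto_add[of "cube_mean f" a at_top "cube_mean g" b] assms(3,4)
    by (simp add: has_mean_def)
qed

lemma has_mean_cmult: "has_mean f a \<Longrightarrow> has_mean (\<lambda>x. c * f x) (c * a)"
  using tendsto_mult_left[of "cube_mean f" a at_top c]
  unfolding has_mean_def cube_mean_def by (simp add: mult.left_commute)

lemma has_mean_sum:
  assumes "finite I" "\<And>i. i \<in> I \<Longrightarrow> continuous_on UNIV (f i)" "\<And>i. i \<in> I \<Longrightarrow> has_mean (f i) (a i)"
  shows "has_mean (\<lambda>x. \<Sum>i\<in>I. f i x) (\<Sum>i\<in>I. a i)"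
  using assms
  by (induction I rule: finite_induct)
     (auto intro!: has_mean_const has_mean_add continuous_intros)

lemma has_mean_unique: "has_mean f a \<Longrightarrow> has_mean f b \<Longrightarrow> a = b"
  unfolding has_mean_def using tendsto_unique[OF trivial_limit_at_top_linorder] by blast

text \<open>
  The inequality passes from the integrals to their limits. Besides bounding means by suprema, this
  controls the mean of a product with a nonnegative kernel by the mean of the kernel.
\<close>
lemma has_mean_dominated:
  assumes cont: "continuous_on UNIV f" "continuous_on UNIV g"
    and m: "has_mean f a" "has_mean (\<lambda>x. complex_of_real (g x)) b"
    and le: "\<And>x. cmod (f x) \<le> g x"
  shows "cmod a \<le> Re b"
proof -
  have b: "((\<lambda>T. Re (cube_mean (\<lambda>x. complex_of_real (g x)) T)) \<longlongrightarrow> Re b) at_top"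
    using m(2) unfolding has_mean_def by (rule tendsto_Re)
  have a: "((\<lambda>T. cmod (cube_mean f T)) \<longlongrightarrow> cmod a) at_top"
    using m(1) unfolding has_mean_def by (rule tendsto_norm)
  have "eventually (\<lambda>T. cmod (cube_mean f T) \<le> Re (cube_mean (\<lambda>x. complex_of_real (g x)) T)) at_top"
  proof (rule eventually_mono[OF eventually_gt_at_top[of 0]])
    fix T :: real assume T: "T > 0"
    have gi: "g integrable_on cube T" using cont(2) by (rule continuous_integrable_on_cbox)
    have *: "cmod (integral (cube T) f) \<le> integral (cube T) g"
      by (rule Henstock_Kurzweil_Integration.integral_norm_bound_integral)
         (use cont le in \<open>auto intro: continuous_integrable_on_cbox\<close>)
    have of_real: "integral (cube T) (\<lambda>x. complex_of_real (g x)) = complex_of_real (integral (cube T) g)"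
      using gi by (metis has_integral_of_real integrable_integral integral_unique)
    have 1: "cmod (cube_mean f T) = 1 / (2 * T) ^ CARD('a) * cmod (integral (cube T) f)"
      using T by (simp add: cube_mean_def norm_mult norm_divide norm_power)
    have 2: "cube_mean (\<lambda>x. complex_of_real (g x)) T
        = complex_of_real (1 / (2 * T) ^ CARD('a) * integral (cube T) g)"
      unfolding cube_mean_def of_real by simp
    show "cmod (cube_mean f T) \<le> Re (cube_mean (\<lambda>x. complex_of_real (g x)) T)"
      unfolding 1 2 Re_complex_of_real by (rule mult_left_mono[OF *]) (use T in auto)
  qed
  then show ?thesis using tendsto_le[OF _ b a] by simp
qed

lemma cube_mean_bound:
  assumes "continuous_on UNIV f" "\<And>x. cmod (f x) \<le> B" "T > 0"
  shows "cmod (cube_mean (f :: real ^ 'k \<Rightarrow> complex) T) \<le> B"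
proof -
  have B: "B \<ge> 0" using assms(2)[of 0] norm_ge_zero order_trans by blast
  have "cmod (integral (cube T) f) \<le> B * measure lborel (cube T :: (real ^ 'k) set)"
    by (rule has_integral_bound[OF B integrable_integral])
       (use assms in \<open>auto intro: continuous_integrable_on_cbox\<close>)
  then show ?thesis using assms(3)
    by (simp add: cube_mean_def content_cube norm_mult norm_divide norm_power field_simps)
qed

lemma integral_subcube_diff:
  fixes f :: "real ^ 'k \<Rightarrow> complex"
  assumes cont: "continuous_on UNIV f" and B: "\<And>x. cmod (f x) \<le> B"
    and sub: "cbox c d \<subseteq> cbox a b"
  shows "cmod (integral (cbox a b) f - integral (cbox c d) f)
    \<le> B * (measure lborel (cbox a b) - measure lborel (cbox c d))"
proof -
  let ?I = "\<lambda>x. if x \<in> cbox c d then f x else 0"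
  let ?J = "\<lambda>x. if x \<in> cbox c d then B else 0"
  have fi: "(?I has_integral integral (cbox c d) f) (cbox a b)"
    using has_integral_restrict_closed_subinterval[OF integrable_integral sub]
      continuous_integrable_on_cbox[OF cont] by blast
  have 1: "((\<lambda>x. f x - ?I x) has_integral (integral (cbox a b) f - integral (cbox c d) f)) (cbox a b)"
    by (intro has_integral_diff fi integrable_integral continuous_integrable_on_cbox cont)
  have "(?J has_integral measure lborel (cbox c d) *\<^sub>R B) (cbox a b)"
    by (rule has_integral_restrict_closed_subinterval[OF has_integral_const sub])
  then have 2: "((\<lambda>x. B - ?J x) has_integral (measure lborel (cbox a b) *\<^sub>R B - measure lborel (cbox c d) *\<^sub>R B)) (cbox a b)"
    by (intro has_integral_diff has_integral_const)
  have "cmod (integral (cbox a b) (\<lambda>x. f x - ?I x)) \<le> integral (cbox a b) (\<lambda>x. B - ?J x)"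
    by (rule Henstock_Kurzweil_Integration.integral_norm_bound_integral)
       (use 1 2 B in \<open>auto simp: has_integral_integrable\<close>)
  then show ?thesis
    unfolding integral_unique[OF 1] integral_unique[OF 2] by (simp add: algebra_simps)
qed

text \<open>
  A cube and its translate by \<open>h\<close> have the same volume and both contain the concentric cube whose
  half side is shorter by \<open>norm h\<close>, which fills almost all of either of them when \<open>T\<close> is large.
\<close>
lemma has_mean_shift:
  fixes f :: "real ^ 'k \<Rightarrow> complex"
  assumes cont: "continuous_on UNIV f" and B: "\<And>x. cmod (f x) \<le> B"
  shows "((\<lambda>T. cube_mean (\<lambda>x. f (x + h)) T - cube_mean f T) \<longlongrightarrow> 0) at_top"
proof -
  define c where "c = norm h"
  have hc: "\<bar>vec_nth h i\<bar> \<le> c" for i unfolding c_def by (rule component_le_norm_cart)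
  have c0: "c \<ge> 0" unfolding c_def by simp
  let ?N = "CARD('k)"
  have bound: "cmod (cube_mean (\<lambda>x. f (x + h)) T - cube_mean f T) \<le> 2 * B * (1 - (1 - c / T) ^ ?N)"
    if T: "T > c" "T > 0" for T
  proof -
    define v where "v = (\<chi> i. T) + h"
    define u where "u = (\<chi> i. - T) + h"
    have sub1: "cube (T - c) \<subseteq> (cube T :: (real ^ 'k) set)"
      using c0 by (auto simp: mem_box_cart) (smt (verit) le_diff_eq)+
    have sub2: "cube (T - c) \<subseteq> cbox u v"
    proof
      fix x :: "real ^ 'k" assume x: "x \<in> cube (T - c)"
      have "vec_nth u i \<le> vec_nth x i \<and> vec_nth x i \<le> vec_nth v i" for i
      proof -
        have "c - T \<le> vec_nth x i \<and> vec_nth x i \<le> T - c" using x by (auto simp: mem_box_cart)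
        then show ?thesis using hc[of i] by (auto simp: u_def v_def)
      qed
      then show "x \<in> cbox u v" by (auto simp: mem_box_cart)
    qed
    have uv: "measure lborel (cbox u v) = (2 * T) ^ ?N"
      using T by (subst content_cbox_cart) (auto simp: interval_ne_empty_cart u_def v_def)
    have "((\<lambda>x. f (1 *\<^sub>R x + h)) has_integral (integral (cbox u v) f /\<^sub>R 1 ^ DIM(real ^ 'k)))
        (cbox ((u - h) /\<^sub>R 1) ((v - h) /\<^sub>R 1))"
      by (rule has_integral_affinity'[OF integrable_integral])
         (auto intro: continuous_integrable_on_cbox cont)
    then have sh: "integral (cube T) (\<lambda>x. f (x + h)) = integral (cbox u v) f"
      by (intro integral_unique) (simp add: u_def v_def)
    have ct: "measure lborel (cube (T - c) :: (real ^ 'k) set) = (2 * (T - c)) ^ ?N"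
      "measure lborel (cube T :: (real ^ 'k) set) = (2 * T) ^ ?N"
      using T by (simp_all only: content_cube)
    have 1: "cmod (integral (cube T) f - integral (cube (T - c)) f) \<le> B * ((2 * T) ^ ?N - (2 * (T - c)) ^ ?N)"
      using integral_subcube_diff[OF cont B sub1] unfolding ct .
    have 2: "cmod (integral (cbox u v) f - integral (cube (T - c)) f) \<le> B * ((2 * T) ^ ?N - (2 * (T - c)) ^ ?N)"
      using integral_subcube_diff[OF cont B sub2] unfolding ct uv .
    have 3: "cmod (integral (cbox u v) f - integral (cube T) f) \<le> 2 * (B * ((2 * T) ^ ?N - (2 * (T - c)) ^ ?N))"
      using norm_triangle_ineq4[of "integral (cbox u v) f - integral (cube (T - c)) f"
          "integral (cube T) f - integral (cube (T - c)) f"] 1 2 by simp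
    have "cmod (cube_mean (\<lambda>x. f (x + h)) T - cube_mean f T)
        = cmod (integral (cbox u v) f - integral (cube T) f) / (2 * T) ^ ?N"
      unfolding cube_mean_def sh using T
      by (simp add: norm_divide norm_power norm_mult flip: right_diff_distrib diff_divide_distrib)
    also have "\<dots> \<le> 2 * (B * ((2 * T) ^ ?N - (2 * (T - c)) ^ ?N)) / (2 * T) ^ ?N"
      by (rule divide_right_mono[OF 3]) (use T in auto)
    also have "\<dots> = 2 * B * (1 - ((2 * (T - c)) / (2 * T)) ^ ?N)"
    proof -
      have "2 * (B * (X - Y)) / X = 2 * B * (1 - Y / X)" if "X \<noteq> 0" for X Y :: real
        using that by (simp add: field_simps)
      then show ?thesis unfolding power_divide using T by simp
    qed
    also have "(2 * (T - c)) / (2 * T) = 1 - c / T" using T by (simp add: diff_divide_distrib)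
    finally show ?thesis .
  qed
  have "((\<lambda>T. c / T) \<longlongrightarrow> 0) at_top"
    by (rule tendsto_divide_0[OF tendsto_const]) (simp add: filterlim_at_top_imp_at_infinity filterlim_ident)
  then have "((\<lambda>T. 2 * B * (1 - (1 - c / T) ^ ?N)) \<longlongrightarrow> 2 * B * (1 - (1 - 0) ^ ?N)) at_top"
    by (intro tendsto_intros)
  then have lim: "((\<lambda>T. 2 * B * (1 - (1 - c / T) ^ ?N)) \<longlongrightarrow> 0) at_top" by simp
  show ?thesis
    by (rule Lim_null_comparison[OF _ lim])
       (use bound in \<open>auto intro: eventually_mono[OF eventually_gt_at_top[of "max c 0"]]\<close>)
qed

text \<open>
  Translation by a half period \<open>h\<close> multiplies \<open>e_fun l\<close> by \<open>-1\<close>, whereas asymptotically it leaves the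
  cube means unchanged. This avoids computing the integral over the cube coordinate by coordinate.
\<close>
lemma has_mean_e_fun:
  fixes l :: "real ^ 'k"
  assumes "l \<noteq> 0"
  shows "has_mean (e_fun l) 0"
proof -
  define h where "h = (pi / (l \<bullet> l)) *\<^sub>R l"
  have "e_fun l h = -1" using assms by (simp add: e_fun_def h_def)
  then have eq: "e_fun l (x + h) = (-1) * e_fun l x" for x by (simp add: e_fun_shift)
  have "((\<lambda>T. cube_mean (\<lambda>x. e_fun l (x + h)) T - cube_mean (e_fun l) T) \<longlongrightarrow> 0) at_top"
    by (rule has_mean_shift[where B = 1]) (auto intro: continuous_intros)
  also have "(\<lambda>T. cube_mean (\<lambda>x. e_fun l (x + h)) T - cube_mean (e_fun l) T) = (\<lambda>T. (-2) * cube_mean (e_fun l) T)"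
    unfolding eq cube_mean_def by (auto simp: fun_eq_iff)
  finally have "((\<lambda>T. (-1/2) * ((-2) * cube_mean (e_fun l) T)) \<longlongrightarrow> (-1/2) * 0) at_top"
    by (rule tendsto_mult_left)
  then show ?thesis by (simp add: has_mean_def)
qed

text \<open>
  The means of the approximants form a Cauchy sequence, and cube means depend on the function uniformly
  in \<open>T\<close>, so the two limits can be interchanged.
\<close>
lemma has_mean_uniform_limit:
  fixes f :: "real ^ 'k \<Rightarrow> complex"
  assumes F: "\<And>n. continuous_on UNIV (F n)" "\<And>n. has_mean (F n) (a n)"
    and lim: "uniform_limit UNIV F f sequentially"
  shows "\<exists>b. has_mean f b"
proof -
  have f: "continuous_on UNIV f" by (rule uniform_limit_theorem[OF _ lim]) (auto intro!: always_eventually F)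
  have diff: "has_mean (\<lambda>x. F n x + (-1) * F m x) (a n + (-1) * a m)" for n m
    using F by (intro has_mean_add has_mean_cmult continuous_intros)
  have adist: "dist (a n) (a m) \<le> e" if "\<And>x. dist (F n x) (F m x) \<le> e" for n m e
  proof -
    have "cmod (a n + (-1) * a m) \<le> Re (complex_of_real e)"
      by (rule has_mean_dominated[OF _ _ diff[of n m] has_mean_const])
         (use that F(1) in \<open>auto simp: dist_norm intro!: continuous_intros\<close>)
    then show ?thesis by (simp add: dist_norm)
  qed
  have "Cauchy a"
  proof (rule metric_CauchyI)
    fix e :: real assume "e > 0"
    then obtain N where N: "\<And>n x. n \<ge> N \<Longrightarrow> dist (F n x) (f x) < e / 4"
      using uniform_limitD[OF lim, of "e / 4"] by (auto simp: eventually_sequentially)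
    have "dist (a n) (a m) < e" if "n \<ge> N" "m \<ge> N" for n m
    proof -
      have "dist (F n x) (F m x) \<le> e / 2" for x
        using dist_triangle2[of "F n x" "F m x" "f x"] N[OF that(1), of x] N[OF that(2), of x] by simp
      then show ?thesis using adist[of n m "e / 2"] \<open>e > 0\<close> by simp
    qed
    then show "\<exists>M. \<forall>m\<ge>M. \<forall>n\<ge>M. dist (a m) (a n) < e" by blast
  qed
  then obtain b where b: "a \<longlonglongrightarrow> b" using Cauchy_convergent convergent_def by blast
  have "(cube_mean f \<longlongrightarrow> b) at_top"
  proof (rule swap_uniform_limit'[where F = sequentially and S = "{0<..}"])
    show "\<forall>\<^sub>F n in sequentially. (cube_mean (F n) \<longlongrightarrow> a n) at_top"
      using F(2) by (simp add: has_mean_def)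
    show "(a \<longlongrightarrow> b) sequentially" by (rule b)
    show "uniform_limit {0<..} (\<lambda>n. cube_mean (F n)) (cube_mean f) sequentially"
    proof (rule uniform_limitI)
      fix e :: real assume "e > 0"
      then have "eventually (\<lambda>n. \<forall>x\<in>UNIV. dist (F n x) (f x) < e / 2) sequentially"
        by (intro uniform_limitD[OF lim]) simp
      then show "eventually (\<lambda>n. \<forall>T\<in>{0<..}. dist (cube_mean (F n) T) (cube_mean f T) < e) sequentially"
      proof (rule eventually_mono)
        fix n assume n: "\<forall>x\<in>UNIV. dist (F n x) (f x) < e / 2"
        have "dist (cube_mean (F n) T) (cube_mean f T) < e" if "T > 0" for T
        proof -
          have "cube_mean (F n) T - cube_mean f T = cube_mean (\<lambda>x. F n x - f x) T"
            using F(1) f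
            by (simp add: cube_mean_def continuous_integrable_on_cbox integral_diff right_diff_distrib
                flip: diff_divide_distrib)
          also have "cmod \<dots> \<le> e / 2"
            by (rule cube_mean_bound)
               (use n that F(1) f in \<open>auto simp: dist_norm intro: less_imp_le intro!: continuous_intros\<close>)
          finally show ?thesis using \<open>e > 0\<close> by (simp add: dist_norm)
        qed
        then show "\<forall>T\<in>{0<..}. dist (cube_mean (F n) T) (cube_mean f T) < e" by auto
      qed
    qed
  qed (use eventually_gt_at_top[of 0] in auto)
  then show ?thesis by (auto simp: has_mean_def)
qed

section \<open>Folner sets of finitely generated groups\<close>

text \<open>
  Otherwise \<open>a\<close> would grow by the factor \<open>1 + d\<close> at every step, faster than any polynomial.
\<close>
lemma exists_small_growth:
  fixes a :: "nat \<Rightarrow> nat"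
  assumes pos: "\<And>N. a (Suc N) > 0" and poly: "\<And>N. a N \<le> N ^ r" and d: "(d :: real) > 0"
  shows "\<exists>N. real (a (Suc (Suc N))) \<le> (1 + d) * a (Suc N)"
proof (rule ccontr)
  assume "\<not> ?thesis"
  then have gr: "real (a (Suc (Suc N))) > (1 + d) * a (Suc N)" for N by (auto simp: not_le)
  have ge: "real (a (Suc N)) \<ge> (1 + d) ^ N" for N
  proof (induction N)
    case 0 then show ?case using pos[of 0] by simp
  next
    case (Suc N)
    have "(1 + d) ^ Suc N \<le> (1 + d) * a (Suc N)" using Suc d by simp
    then show ?case using gr[of N] by linarith
  qed
  have le: "(1 + d) ^ N \<le> real (Suc N) ^ r" for N
  proof -
    have "real (a (Suc N)) \<le> real (Suc N ^ r)" using poly[of "Suc N"] by (simp only: of_nat_le_iff)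
    then show ?thesis using ge[of N] unfolding of_nat_power by linarith
  qed
  have "((\<lambda>N. real (Suc N) ^ r / (1 + d) ^ N) \<longlonglongrightarrow> 0)"
    using d by real_asymp
  then have "eventually (\<lambda>N. real (Suc N) ^ r / (1 + d) ^ N < 1) sequentially"
    by (rule order_tendstoD) simp
  then obtain N where "real (Suc N) ^ r / (1 + d) ^ N < 1" by (auto simp: eventually_sequentially)
  then show False using le[of N] d by (simp add: divide_less_eq)
qed

text \<open>
  The sets \<open>V N\<close> of combinations of elements of \<open>L\<close> with coefficients below \<open>N\<close> grow at most
  polynomially in \<open>N\<close>, and \<open>V N\<close> translated by an element of \<open>L\<close> stays inside \<open>V (N + 1)\<close>. At an \<open>N\<close> where
  the cardinality hardly grows, \<open>V N\<close> therefore overlaps almost completely with each translate.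
\<close>
lemma exists_Folner_set:
  fixes L :: "'a :: real_vector set"
  assumes L: "finite L" and d: "(d :: real) > 0"
  shows "\<exists>V. finite V \<and> V \<noteq> {} \<and> (\<forall>l\<in>L. real (card {u \<in> V. u + l \<in> V}) \<ge> (1 - d) * card V)"
proof -
  define V where "V N = (\<lambda>n. \<Sum>l\<in>L. real (n l) *\<^sub>R l) ` (L \<rightarrow>\<^sub>E {..<N})" for N :: nat
  have fin: "finite (V N)" for N unfolding V_def using L by (intro finite_imageI finite_PiE) auto
  have ne: "V (Suc N) \<noteq> {}" for N unfolding V_def by (auto simp: PiE_eq_empty_iff)
  have card: "card (V N) \<le> N ^ card L" for N
    unfolding V_def using card_image_le[of "L \<rightarrow>\<^sub>E {..<N}" "\<lambda>n. \<Sum>l\<in>L. real (n l) *\<^sub>R l"] L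
    by (auto simp: card_PiE finite_PiE)
  have mono: "V N \<subseteq> V (Suc N)" for N unfolding V_def by (intro image_mono PiE_mono) auto
  have step: "u + l \<in> V (Suc N)" if u: "u \<in> V N" and l: "l \<in> L" for u l N
  proof -
    obtain n where n: "n \<in> L \<rightarrow>\<^sub>E {..<N}" "u = (\<Sum>l\<in>L. real (n l) *\<^sub>R l)" using u by (auto simp: V_def)
    let ?n = "n(l := Suc (n l))"
    have mem: "?n \<in> L \<rightarrow>\<^sub>E {..<Suc N}" using n(1) l by (auto simp: PiE_iff extensional_def less_Suc_eq)
    have sum: "(\<Sum>k\<in>L. real (?n k) *\<^sub>R k) = u + l"
    proof -
      have "(\<Sum>k\<in>L. real (?n k) *\<^sub>R k) = real (Suc (n l)) *\<^sub>R l + (\<Sum>k\<in>L - {l}. real (?n k) *\<^sub>R k)"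
        using sum.remove[OF L l, of "\<lambda>k. real (?n k) *\<^sub>R k"] by simp
      also have "(\<Sum>k\<in>L - {l}. real (?n k) *\<^sub>R k) = (\<Sum>k\<in>L - {l}. real (n k) *\<^sub>R k)"
        by (rule sum.cong) auto
      also have "real (Suc (n l)) *\<^sub>R l + (\<Sum>k\<in>L - {l}. real (n k) *\<^sub>R k) = u + l"
        unfolding n(2) using sum.remove[OF L l, of "\<lambda>k. real (n k) *\<^sub>R k"] by (simp add: scaleR_add_left)
      finally show ?thesis .
    qed
    show ?thesis unfolding V_def sum[symmetric] by (rule imageI[OF mem])
  qed
  obtain N where N: "real (card (V (Suc (Suc N)))) \<le> (1 + d) * card (V (Suc N))"
    using exists_small_growth[of "\<lambda>N. card (V N)", OF _ card d] fin ne by (auto simp: card_gt_0_iff)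
  let ?V = "V (Suc N)"
  have "(1 - d) * card ?V \<le> real (card {u \<in> ?V. u + l \<in> ?V})" if l: "l \<in> L" for l
  proof -
    let ?W = "(\<lambda>u. u + l) ` ?V"
    have inj: "inj_on (\<lambda>u. u + l) A" for A by (auto intro: inj_onI)
    have "card (?V \<union> ?W) \<le> card (V (Suc (Suc N)))"
      using mono[of "Suc N"] step[OF _ l, of _ "Suc N"] by (intro card_mono fin) auto
    moreover have "card ?V + card ?W = card (?V \<union> ?W) + card (?V \<inter> ?W)"
      by (rule card_Un_Int) (auto intro: fin)
    moreover have "card ?W = card ?V" by (rule card_image[OF inj])
    moreover have "card (?V \<inter> ?W) = card {u \<in> ?V. u + l \<in> ?V}"
    proof -
      have "?V \<inter> ?W = (\<lambda>u. u + l) ` {u \<in> ?V. u + l \<in> ?V}" by auto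
      then show ?thesis by (simp only: card_image[OF inj])
    qed
    ultimately have "2 * card ?V \<le> card (V (Suc (Suc N))) + card {u \<in> ?V. u + l \<in> ?V}" by linarith
    then have "2 * real (card ?V) \<le> card (V (Suc (Suc N))) + real (card {u \<in> ?V. u + l \<in> ?V})" by linarith
    then show ?thesis using N by (simp add: algebra_simps)
  qed
  then show ?thesis using fin[of "Suc N"] ne[of N] by blast
qed

section \<open>Trigonometric polynomials\<close>

text \<open>
  A trigonometric polynomial is given by a list of coefficients and exponents. Exponents may repeat, so
  that sums and products of polynomials are given by list operations, and so that an operation on the
  exponents can be defined on the list.
\<close>
definition trig :: "(complex \<times> (real ^ 'k)) list \<Rightarrow> real ^ 'k \<Rightarrow> complex" where
  "trig xs x = (\<Sum>(c, l)\<leftarrow>xs. c * e_fun l x)"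

lemma trig_Nil [simp]: "trig [] x = 0" and trig_Cons [simp]: "trig ((c, l) # xs) x = c * e_fun l x + trig xs x"
  by (simp_all add: trig_def)

lemma trig_append: "trig (xs @ ys) x = trig xs x + trig ys x"
  by (simp add: trig_def)

lemma trig_scale: "trig (map (\<lambda>(c, l). (a * c, l)) xs) x = a * trig xs x"
  by (induction xs) (auto simp: distrib_left)

lemma trig_mult:
  "trig (concat (map (\<lambda>(c, l). map (\<lambda>(d, m). (c * d, l + m)) ys) xs)) x = trig xs x * trig ys x"
proof -
  have "trig (map (\<lambda>(d, m). (c * d, l + m)) ys) x = c * e_fun l x * trig ys x" for c l
    by (induction ys) (auto simp: distrib_left e_fun_add)
  then show ?thesis by (induction xs) (auto simp: trig_append distrib_right)
qed

lemma trig_norm_le: "cmod (trig xs x) \<le> (\<Sum>(c, l)\<leftarrow>xs. cmod c)"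
  by (induction xs) (auto intro!: norm_triangle_mono simp: norm_mult)

lemma trig_AP: "trig xs \<in> AP"
proof (induction xs)
  case Nil
  then show ?case using AP_const[of 0] by (simp add: trig_def[abs_def])
next
  case (Cons a xs)
  obtain c l where a: "a = (c, l)" by (cases a)
  have "trig (a # xs) = (\<lambda>x. c * e_fun l x) + trig xs" by (auto simp: a fun_eq_iff)
  then show ?case using AP_add[OF AP_scale[OF AP_e] Cons] by (simp only:)
qed

text \<open>
  The term \<open>f * (g - q) + (f - p) * q\<close> uses a bound for \<open>f\<close> and one for \<open>q\<close>. In applications \<open>q\<close> is
  chosen before \<open>p\<close>, whose quality depends on \<open>C\<close>.
\<close>
lemma norm_product_approx:
  fixes f g p q :: "'a \<Rightarrow> complex"
  assumes B: "B > 0" "\<And>x. cmod (f x) \<le> B" and C: "C > 0" "\<And>x. cmod (q x) \<le> C"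
    and p: "\<And>x. cmod (f x - p x) \<le> e / (2 * C)" and q: "\<And>x. cmod (g x - q x) \<le> e / (2 * B)"
  shows "cmod (f x * g x - p x * q x) \<le> e"
proof -
  have "f x * g x - p x * q x = f x * (g x - q x) + (f x - p x) * q x"
    by (simp add: algebra_simps)
  also have "cmod \<dots> \<le> B * (e / (2 * B)) + e / (2 * C) * C"
  proof (rule norm_triangle_mono)
    show "cmod (f x * (g x - q x)) \<le> B * (e / (2 * B))"
      unfolding norm_mult by (rule mult_mono[OF B(2) q]) (use B in auto)
    show "cmod ((f x - p x) * q x) \<le> e / (2 * C) * C"
      unfolding norm_mult by (rule mult_mono[OF p C(2)]) (use C norm_ge_zero[THEN order_trans, OF p] in auto)
  qed
  also have "\<dots> = e" using B C by simp
  finally show ?thesis .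
qed

text \<open>
  Uniform limits of trigonometric polynomials are closed under all the operations that generate \<open>AP\<close>.
\<close>
lemma AP_trig_approx:
  assumes "f \<in> AP" shows "\<forall>e>0. \<exists>xs. \<forall>x. cmod (f x - trig xs x) \<le> e"
  using assms
proof (induction rule: AP.induct)
  case (AP_e l)
  have "e_fun l x - trig [(1, l)] x = 0" for x by simp
  then show ?case by (metis norm_zero less_imp_le)
next
  case (AP_add f g)
  show ?case
  proof (intro allI impI)
    fix e :: real assume "e > 0"
    then obtain xs ys where "\<And>x. cmod (f x - trig xs x) \<le> e / 2" "\<And>x. cmod (g x - trig ys x) \<le> e / 2"
      using AP_add.IH by (meson half_gt_zero)
    then have "cmod ((f + g) x - trig (xs @ ys) x) \<le> e / 2 + e / 2" for x
      unfolding trig_append plus_fun_apply add_diff_add by (intro norm_triangle_mono)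
    then show "\<exists>xs. \<forall>x. cmod ((f + g) x - trig xs x) \<le> e" by auto
  qed
next
  case (AP_scale f c)
  show ?case
  proof (intro allI impI)
    fix e :: real assume "e > 0"
    then have "e / (cmod c + 1) > 0" by (intro divide_pos_pos add_nonneg_pos) auto
    then obtain xs where xs: "\<And>x. cmod (f x - trig xs x) \<le> e / (cmod c + 1)" using AP_scale.IH by blast
    have "cmod (c * f x - trig (map (\<lambda>(d, l). (c * d, l)) xs) x) \<le> e" for x
    proof -
      have "cmod (c * f x - trig (map (\<lambda>(d, l). (c * d, l)) xs) x) = cmod c * cmod (f x - trig xs x)"
        by (simp add: trig_scale norm_mult flip: right_diff_distrib)
      also have "\<dots> \<le> (cmod c + 1) * (e / (cmod c + 1))" by (intro mult_mono xs) auto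
      also have "\<dots> = e" by (simp add: add_nonneg_eq_0_iff)
      finally show ?thesis .
    qed
    then show "\<exists>xs. \<forall>x. cmod (c * f x - trig xs x) \<le> e" by blast
  qed
next
  case (AP_mult f g)
  obtain B where B: "B > 0" "\<And>x. cmod (f x) \<le> B" using AP_bounded[OF AP_mult(1)] by auto
  show ?case
  proof (intro allI impI)
    fix e :: real assume e: "e > 0"
    then obtain ys where ys: "\<And>x. cmod (g x - trig ys x) \<le> e / (2 * B)"
      using AP_mult.IH(2) B by (meson divide_pos_pos mult_pos_pos zero_less_numeral)
    define C where "C = (\<Sum>(c, l)\<leftarrow>ys. cmod c) + 1"
    have C: "C > 0" "\<And>x. cmod (trig ys x) \<le> C"
      using trig_norm_le[of ys] by (force simp: C_def intro: add_nonneg_pos sum_list_nonneg order_trans)+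
    obtain xs where xs: "\<And>x. cmod (f x - trig xs x) \<le> e / (2 * C)"
      using AP_mult.IH(1) C e by (meson divide_pos_pos mult_pos_pos zero_less_numeral)
    let ?zs = "concat (map (\<lambda>(c, l). map (\<lambda>(d, m). (c * d, l + m)) ys) xs)"
    have "cmod ((f * g) x - trig ?zs x) \<le> e" for x
      using norm_product_approx[OF B C xs ys] by (simp add: trig_mult)
    then show "\<exists>xs. \<forall>x. cmod ((f * g) x - trig xs x) \<le> e" by blast
  qed
next
  case (AP_closed F f)
  show ?case
  proof (intro allI impI)
    fix e :: real assume e: "e > 0"
    from uniform_limitD[OF AP_closed.hyps(2), of "e / 2"] e obtain n where n: "\<And>x. dist (F n x) (f x) < e / 2"
      by (auto simp: eventually_sequentially)
    obtain xs where xs: "\<And>x. cmod (F n x - trig xs x) \<le> e / 2" using AP_closed.IH e half_gt_zero by blast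
    have "cmod (f x - trig xs x) \<le> e" for x
      using norm_triangle_ineq4[of "F n x - trig xs x" "F n x - f x"] n[of x] xs[of x] by (simp add: dist_norm)
    then show "\<exists>xs. \<forall>x. cmod (f x - trig xs x) \<le> e" by blast
  qed
qed

section \<open>Bohr coefficients\<close>

lemma uniform_limit_inverse_Suc:
  assumes "\<And>n x. cmod (f x - F n x) \<le> inverse (real (Suc n))"
  shows "uniform_limit UNIV F f sequentially"
proof (rule uniform_limitI)
  fix e :: real assume "e > 0"
  then have "eventually (\<lambda>n. inverse (real (Suc n)) < e) sequentially"
    using LIMSEQ_inverse_real_of_nat order_tendstoD(2) by blast
  then show "\<forall>\<^sub>F n in sequentially. \<forall>x\<in>UNIV. dist (F n x) (f x) < e"
    by (rule eventually_mono)
       (use assms in \<open>auto simp: dist_norm norm_minus_commute intro: le_less_trans\<close>)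
qed

lemma AP_has_mean:
  assumes "f \<in> AP" shows "\<exists>a. has_mean f a"
proof -
  have "\<forall>n. \<exists>xs. \<forall>x. cmod (f x - trig xs x) \<le> inverse (real (Suc n))"
    using AP_trig_approx[OF assms] by simp
  then obtain xs where xs: "\<And>n x. cmod (f x - trig (xs n) x) \<le> inverse (real (Suc n))" by metis
  have trig: "\<exists>a. has_mean (trig ys) a" for ys :: "(complex \<times> (real ^ 'a)) list"
  proof (induction ys)
    case Nil
    then show ?case using has_mean_const[of 0] by (auto simp: trig_def[abs_def])
  next
    case (Cons z zs)
    then obtain a where a: "has_mean (trig zs) a" by blast
    obtain c l where z: "z = (c, l)" by (cases z)
    obtain b where "has_mean (e_fun l) b"
      by (cases "l = 0") (auto simp: e_fun_zero intro: has_mean_const has_mean_e_fun)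
    then have "has_mean (\<lambda>x. c * e_fun l x + trig zs x) (c * b + a)"
      by (intro has_mean_add has_mean_cmult a continuous_intros AP_continuous trig_AP)
    then show ?case unfolding z by (auto simp: fun_eq_iff intro!: exI)
  qed
  then have "\<forall>n. \<exists>a. has_mean (trig (xs n)) a" by blast
  then obtain a where a: "\<And>n. has_mean (trig (xs n)) (a n)" by metis
  have "uniform_limit UNIV (\<lambda>n. trig (xs n)) f sequentially"
    by (rule uniform_limit_inverse_Suc) (rule xs)
  then show ?thesis
    by (rule has_mean_uniform_limit[OF AP_continuous[OF trig_AP] a])
qed

text \<open>
  This is the bridge to the definition of \<open>bohr_coeff\<close> by \<open>Lim\<close>, which is meaningful only because
  the limit exists.
\<close>
lemma has_mean_bohr_coeff:
  assumes "f \<in> AP" shows "has_mean (\<lambda>x. e_fun (- l) x * f x) (bohr_coeff f l)"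
proof -
  have "e_fun (- l) * f \<in> AP" by (intro AP_mult AP_e assms)
  then obtain a where a: "has_mean (\<lambda>x. e_fun (- l) x * f x) a"
    using AP_has_mean unfolding times_fun_def by blast
  have "bohr_coeff f l = Lim at_top (cube_mean (\<lambda>x. e_fun (- l) x * f x))"
    unfolding bohr_coeff_def cube_mean_def e_fun_def by (simp add: inner_minus_left)
  also have "\<dots> = a" using a unfolding has_mean_def by (intro tendsto_Lim) auto
  finally show ?thesis using a by simp
qed

lemma bohr_coeff_add:
  assumes "f \<in> AP" "g \<in> AP"
  shows "bohr_coeff (f + g) l = bohr_coeff f l + bohr_coeff g l"
proof (rule has_mean_unique)
  show "has_mean (\<lambda>x. e_fun (- l) x * (f + g) x) (bohr_coeff (f + g) l)"
    by (intro has_mean_bohr_coeff AP_add assms)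
  have "has_mean (\<lambda>x. e_fun (- l) x * f x + e_fun (- l) x * g x) (bohr_coeff f l + bohr_coeff g l)"
    by (intro has_mean_add has_mean_bohr_coeff continuous_intros AP_continuous assms)
  then show "has_mean (\<lambda>x. e_fun (- l) x * (f + g) x) (bohr_coeff f l + bohr_coeff g l)"
    by (simp add: distrib_left)
qed

lemma bohr_coeff_scale:
  assumes "f \<in> AP"
  shows "bohr_coeff (\<lambda>x. c * f x) l = c * bohr_coeff f l"
proof (rule has_mean_unique)
  show "has_mean (\<lambda>x. e_fun (- l) x * (c * f x)) (bohr_coeff (\<lambda>x. c * f x) l)"
    by (intro has_mean_bohr_coeff AP_scale assms)
  show "has_mean (\<lambda>x. e_fun (- l) x * (c * f x)) (c * bohr_coeff f l)"
    using has_mean_cmult[OF has_mean_bohr_coeff[OF assms, of l], of c] by (simp add: mult.left_commute)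
qed

lemma bohr_coeff_e_fun: "bohr_coeff (e_fun l) m = (if l = m then 1 else 0)"
proof (rule has_mean_unique)
  show "has_mean (\<lambda>x. e_fun (- m) x * e_fun l x) (bohr_coeff (e_fun l) m)"
    by (intro has_mean_bohr_coeff AP_e)
  have "(\<lambda>x. e_fun (- m) x * e_fun l x) = e_fun (l - m)"
    by (simp add: fun_eq_iff flip: e_fun_add)
  then show "has_mean (\<lambda>x. e_fun (- m) x * e_fun l x) (if l = m then 1 else 0)"
    using has_mean_e_fun[of "l - m"] by (auto simp: e_fun_zero intro: has_mean_const)
qed

lemma bohr_coeff_bound:
  assumes f: "f \<in> AP" and B: "\<And>x. cmod (f x) \<le> B"
  shows "cmod (bohr_coeff f l) \<le> B"
proof -
  have "cmod (bohr_coeff f l) \<le> Re (complex_of_real B)"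
    by (rule has_mean_dominated[OF _ _ has_mean_bohr_coeff[OF f] has_mean_const])
       (use B in \<open>auto simp: norm_mult intro!: continuous_intros AP_continuous[OF f]\<close>)
  then show ?thesis by simp
qed

lemma AP_diff: "f \<in> AP \<Longrightarrow> g \<in> AP \<Longrightarrow> (\<lambda>x. f x - g x) \<in> AP"
  using AP_add[OF _ AP_scale[of g "-1"], of f] by (simp add: plus_fun_def)

lemma bohr_coeff_diff:
  assumes "f \<in> AP" "g \<in> AP"
  shows "bohr_coeff (\<lambda>x. f x - g x) l = bohr_coeff f l - bohr_coeff g l"
  using bohr_coeff_add[OF assms(1) AP_scale[OF assms(2), of "-1"], of l] bohr_coeff_scale[OF assms(2), of "-1" l]
  by (simp add: plus_fun_def)

lemma trig_Cons_fun: "trig ((c, l) # xs) = (\<lambda>x. c * e_fun l x) + trig xs"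
  by (simp add: fun_eq_iff)

lemma bohr_coeff_trig_Cons:
  "bohr_coeff (trig ((c, l) # xs)) m = (if l = m then c else 0) + bohr_coeff (trig xs) m"
  unfolding trig_Cons_fun
  by (simp add: bohr_coeff_add bohr_coeff_scale bohr_coeff_e_fun AP_scale AP_e trig_AP)

lemma bohr_coeff_trig_Nil: "bohr_coeff (trig []) m = 0"
  using bohr_coeff_bound[OF trig_AP, of "[]" 0 m] by simp

lemma bohr_coeff_trig_outside: "m \<notin> snd ` set xs \<Longrightarrow> bohr_coeff (trig xs) m = 0"
proof (induction xs)
  case (Cons a xs)
  then show ?case by (cases a) (auto simp: bohr_coeff_trig_Cons simp del: trig_Cons)
qed (simp add: bohr_coeff_trig_Nil)

section \<open>Fejer sums over a finite set\<close>

text \<open>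
  The convolution, in the sense of means, of \<open>f\<close> with \<open>fejer_kernel V\<close>. Written through the Bohr
  coefficients of \<open>f\<close> it is visibly a trigonometric polynomial with exponents in the spectrum of \<open>f\<close>;
  the convolution formula is \<open>has_mean_fejer\<close>.
\<close>
definition fejer_sum :: "(real ^ 'k) set \<Rightarrow> (real ^ 'k \<Rightarrow> complex) \<Rightarrow> real ^ 'k \<Rightarrow> complex" where
  "fejer_sum V f x = 1 / of_nat (card V) * (\<Sum>v\<in>V. \<Sum>u\<in>V. bohr_coeff f (v - u) * e_fun (v - u) x)"

definition fejer_kernel :: "(real ^ 'k) set \<Rightarrow> real ^ 'k \<Rightarrow> real" where
  "fejer_kernel V x = (cmod (\<Sum>v\<in>V. e_fun v x))\<^sup>2 / card V"

lemma fejer_kernel_expand: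
  "complex_of_real (fejer_kernel V x) = 1 / of_nat (card V) * (\<Sum>v\<in>V. \<Sum>u\<in>V. e_fun (v - u) x)"
proof -
  have "complex_of_real ((cmod (\<Sum>v\<in>V. e_fun v x))\<^sup>2) = (\<Sum>v\<in>V. e_fun v x) * cnj (\<Sum>u\<in>V. e_fun u x)"
    by (rule complex_norm_square)
  also have "\<dots> = (\<Sum>v\<in>V. \<Sum>u\<in>V. e_fun (v - u) x)"
    unfolding diff_conv_add_uminus e_fun_add e_fun_uminus by (simp add: sum_product cnj_sum)
  finally show ?thesis by (simp add: fejer_kernel_def)
qed

lemma continuous_on_fejer_kernel [continuous_intros]:
  "continuous_on A g \<Longrightarrow> continuous_on A (\<lambda>x. fejer_kernel V (g x))"
  unfolding fejer_kernel_def divide_inverse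
  by (intro continuous_intros continuous_on_compose2[OF continuous_on_e_fun[of UNIV]]) auto

lemma has_mean_fejer:
  assumes V: "finite V" and f: "f \<in> AP"
  shows "has_mean (\<lambda>y. f y * complex_of_real (fejer_kernel V (x - y))) (fejer_sum V f x)"
proof -
  have "has_mean (\<lambda>y. \<Sum>v\<in>V. \<Sum>u\<in>V. e_fun (v - u) x * (e_fun (- (v - u)) y * f y))
     (\<Sum>v\<in>V. \<Sum>u\<in>V. e_fun (v - u) x * bohr_coeff f (v - u))"
    by (intro has_mean_sum V has_mean_cmult has_mean_bohr_coeff f continuous_intros AP_continuous)
  then have m: "has_mean (\<lambda>y. 1 / of_nat (card V) * (\<Sum>v\<in>V. \<Sum>u\<in>V. e_fun (v - u) x * (e_fun (- (v - u)) y * f y)))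
     (1 / of_nat (card V) * (\<Sum>v\<in>V. \<Sum>u\<in>V. e_fun (v - u) x * bohr_coeff f (v - u)))"
    by (rule has_mean_cmult)
  have 1: "e_fun l (x - y) = e_fun l x * e_fun (- l) y" for l y
    using e_fun_shift[of l x "- y"] by (simp add: e_fun_uminus e_fun_uminus_right)
  have 2: "(\<lambda>y. f y * complex_of_real (fejer_kernel V (x - y))) =
     (\<lambda>y. 1 / of_nat (card V) * (\<Sum>v\<in>V. \<Sum>u\<in>V. e_fun (v - u) x * (e_fun (- (v - u)) y * f y)))"
    unfolding fejer_kernel_expand 1 by (simp add: sum_distrib_left mult_ac)
  show ?thesis using m unfolding 2 fejer_sum_def by (simp add: mult.commute)
qed

lemma fejer_sum_one:
  assumes "finite V" "V \<noteq> {}"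
  shows "fejer_sum V (\<lambda>x. 1) x = 1"
proof -
  have "(\<Sum>v\<in>V. \<Sum>u\<in>V. bohr_coeff (e_fun 0) (v - u) * e_fun (v - u) x) = (\<Sum>v\<in>V. \<Sum>u\<in>V. if u = v then 1 else 0)"
    by (intro sum.cong refl) (simp add: bohr_coeff_e_fun, simp add: e_fun_zero)
  also have "\<dots> = of_nat (card V)" using assms by simp
  finally show ?thesis using assms by (simp add: fejer_sum_def flip: e_fun_zero)
qed

text \<open>
  The kernel is nonnegative and has mean one.
\<close>
lemma norm_fejer_sum_le:
  assumes V: "finite V" "V \<noteq> {}" and f: "f \<in> AP" and B: "\<And>x. cmod (f x) \<le> B"
  shows "cmod (fejer_sum V f x) \<le> B"
proof -
  have "has_mean (\<lambda>y. complex_of_real B * (1 * complex_of_real (fejer_kernel V (x - y)))) (B * fejer_sum V (\<lambda>x. 1) x)"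
    by (intro has_mean_cmult has_mean_fejer V AP_const)
  then have m: "has_mean (\<lambda>y. complex_of_real (B * fejer_kernel V (x - y))) (complex_of_real B)"
    by (simp add: fejer_sum_one V)
  have pos: "fejer_kernel V y \<ge> 0" for y by (simp add: fejer_kernel_def)
  have "cmod (fejer_sum V f x) \<le> Re (complex_of_real B)"
    by (rule has_mean_dominated[OF _ _ has_mean_fejer[OF V(1) f] m])
       (use B pos in \<open>auto simp: norm_mult intro!: continuous_intros AP_continuous[OF f] mult_right_mono\<close>)
  then show ?thesis by simp
qed

lemma fejer_sum_diff:
  "f \<in> AP \<Longrightarrow> g \<in> AP \<Longrightarrow> fejer_sum V (\<lambda>x. f x - g x) x = fejer_sum V f x - fejer_sum V g x"
  by (simp add: fejer_sum_def bohr_coeff_diff left_diff_distrib sum_subtractf diff_divide_distrib)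

text \<open>
  On \<open>e_fun l\<close> the Fejer sum is multiplication by the proportion of \<open>u \<in> V\<close> with \<open>u + l \<in> V\<close>, which is
  close to one when \<open>V\<close> is almost invariant under \<open>l\<close>.
\<close>
lemma norm_fejer_sum_trig_diff:
  assumes V: "finite V" "V \<noteq> {}" and d: "(d :: real) \<ge> 0"
    and fol: "\<And>l. l \<in> snd ` set xs \<Longrightarrow> real (card {u \<in> V. u + l \<in> V}) \<ge> (1 - d) * card V"
  shows "cmod (fejer_sum V (trig xs) x - trig xs x) \<le> d * (\<Sum>(c, l)\<leftarrow>xs. cmod c)"
  using fol
proof (induction xs)
  case Nil
  then show ?case by (simp add: fejer_sum_def bohr_coeff_trig_Nil del: trig_Nil) simp
next
  case (Cons a xs)
  obtain c l where a: "a = (c, l)" by (cases a)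
  let ?k = "card {u \<in> V. u + l \<in> V}"
  have cardV: "card V > 0" using V by (simp add: card_gt_0_iff)
  have "(\<Sum>v\<in>V. \<Sum>u\<in>V. (if l = v - u then c else 0) * e_fun (v - u) x)
      = (\<Sum>u\<in>V. \<Sum>v\<in>V. if v = u + l then c * e_fun l x else 0)"
    by (subst sum.swap) (intro sum.cong refl, auto)
  also have "\<dots> = (\<Sum>u\<in>V. if u + l \<in> V then c * e_fun l x else 0)"
    using V by (simp add: sum.delta')
  also have "\<dots> = of_nat ?k * (c * e_fun l x)"
    using V by (simp add: sum.If_cases Int_def)
  finally have *: "(\<Sum>v\<in>V. \<Sum>u\<in>V. (if l = v - u then c else 0) * e_fun (v - u) x) = of_nat ?k * (c * e_fun l x)" .
  have "fejer_sum V (trig (a # xs)) x = of_nat ?k / of_nat (card V) * (c * e_fun l x) + fejer_sum V (trig xs) x"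
    unfolding fejer_sum_def a bohr_coeff_trig_Cons distrib_right sum.distrib * by (simp add: distrib_left)
  then have eq: "fejer_sum V (trig (a # xs)) x - trig (a # xs) x
      = (of_nat ?k / of_nat (card V) - 1) * (c * e_fun l x) + (fejer_sum V (trig xs) x - trig xs x)"
    by (simp add: a algebra_simps)
  have "real ?k \<le> card V" using V by (auto intro: card_mono)
  moreover have "real ?k \<ge> (1 - d) * card V" using Cons.prems[of l] a by simp
  ultimately have "\<bar>real ?k / card V - 1\<bar> \<le> d"
    using cardV by (simp add: abs_le_iff field_simps)
  moreover have "cmod (of_nat ?k / of_nat (card V) - 1) = \<bar>real ?k / card V - 1\<bar>"
    by (metis (no_types, lifting) norm_of_real of_real_1 of_real_diff of_real_divide of_real_of_nat_eq)
  ultimately have "cmod ((of_nat ?k / of_nat (card V) - 1) * (c * e_fun l x)) \<le> d * cmod c"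
    by (simp add: norm_mult mult_right_mono)
  then show ?case unfolding eq using Cons.IH Cons.prems
    by (auto simp: a distrib_left intro!: norm_triangle_mono)
qed

section \<open>The algebra of almost periodic functions with spectrum in a given set\<close>

lemma sum_trig:
  assumes "finite I" "\<And>i. i \<in> I \<Longrightarrow> c i \<noteq> 0 \<Longrightarrow> l i \<in> D"
  shows "\<exists>xs. snd ` set xs \<subseteq> D \<and> (\<forall>x. trig xs x = (\<Sum>i\<in>I. c i * e_fun (l i) x))"
  using assms
proof (induction I rule: finite_induct)
  case empty
  show ?case by (intro exI[of _ "[]"]) auto
next
  case (insert i I)
  then obtain xs where xs: "snd ` set xs \<subseteq> D" "\<And>x. trig xs x = (\<Sum>i\<in>I. c i * e_fun (l i) x)" by auto
  show ?case
  proof (cases "c i = 0")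
    case True
    then show ?thesis using xs insert by (intro exI[of _ xs]) auto
  next
    case False
    then show ?thesis using xs insert by (intro exI[of _ "(c i, l i) # xs"]) auto
  qed
qed

text \<open>
  Take any trigonometric polynomial close to \<open>f\<close>, with arbitrary exponents, and a Folner set \<open>V\<close> for its
  exponents. The Fejer sum over \<open>V\<close> almost fixes the polynomial and is a contraction, so it almost fixes
  \<open>f\<close>; and the Fejer sum of \<open>f\<close> has exponents in the spectrum of \<open>f\<close>.
\<close>
theorem AP_on_trig_approx:
  assumes f: "f \<in> AP_on D" and e: "e > 0"
  shows "\<exists>xs. snd ` set xs \<subseteq> D \<and> (\<forall>x. cmod (f x - trig xs x) \<le> e)"
proof -
  have fAP: "f \<in> AP" and spec: "\<And>l. bohr_coeff f l \<noteq> 0 \<Longrightarrow> l \<in> D"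
    using f by (auto simp: AP_on_def bohr_spectrum_def)
  obtain ys where ys: "\<And>x. cmod (f x - trig ys x) \<le> e / 3" using AP_trig_approx[OF fAP] e by (meson divide_pos_pos zero_less_numeral)
  \<comment> \<open>The summand \<open>1\<close> keeps \<open>C\<close> positive when \<open>ys\<close> is empty.\<close>
  define C where "C = (\<Sum>(c, l)\<leftarrow>ys. cmod c) + 1"
  have C: "C > 0" unfolding C_def by (auto intro!: add_nonneg_pos sum_list_nonneg)
  have "e / (3 * C) > 0" using e C by simp
  from exists_Folner_set[OF finite_imageI[OF finite_set[of ys], of snd] this]
  obtain V where V: "finite V" "V \<noteq> {}"
    and fol: "\<forall>l\<in>snd ` set ys. real (card {u \<in> V. u + l \<in> V}) \<ge> (1 - e / (3 * C)) * card V"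
    by (elim exE conjE)
  have approx: "cmod (f x - fejer_sum V f x) \<le> e" for x
  proof -
    have 1: "cmod (fejer_sum V (\<lambda>x. f x - trig ys x) x) \<le> e / 3"
      by (intro norm_fejer_sum_le V AP_diff fAP trig_AP ys)
    have "cmod (fejer_sum V (trig ys) x - trig ys x) \<le> e / (3 * C) * (\<Sum>(c, l)\<leftarrow>ys. cmod c)"
      by (rule norm_fejer_sum_trig_diff) (use V fol e C in auto)
    also have "\<dots> \<le> e / (3 * C) * C" using e C by (intro mult_left_mono) (auto simp: C_def)
    also have "\<dots> = e / 3" using C by simp
    finally have 2: "cmod (fejer_sum V (trig ys) x - trig ys x) \<le> e / 3" .
    have "f x - fejer_sum V f x = (f x - trig ys x) - (fejer_sum V (\<lambda>x. f x - trig ys x) x + (fejer_sum V (trig ys) x - trig ys x))"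
      by (simp add: fejer_sum_diff fAP trig_AP)
    also have "cmod \<dots> \<le> e / 3 + (e / 3 + e / 3)"
      using norm_triangle_ineq4 norm_triangle_mono[OF 1 2] ys[of x] by (smt (verit))
    finally show ?thesis by simp
  qed
  have "\<exists>xs. snd ` set xs \<subseteq> D \<and> (\<forall>x. trig xs x
      = (\<Sum>i\<in>V \<times> V. (1 / of_nat (card V) * bohr_coeff f (fst i - snd i)) * e_fun (fst i - snd i) x))"
    by (rule sum_trig) (use V spec in auto)
  then obtain xs where xs: "snd ` set xs \<subseteq> D" and trig: "\<And>x. trig xs x
      = (\<Sum>i\<in>V \<times> V. (1 / of_nat (card V) * bohr_coeff f (fst i - snd i)) * e_fun (fst i - snd i) x)"
    by blast
  have "(\<Sum>i\<in>V \<times> V. (1 / of_nat (card V) * bohr_coeff f (fst i - snd i)) * e_fun (fst i - snd i) x)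
      = fejer_sum V f x" for x
    unfolding fejer_sum_def sum.cartesian_product case_prod_unfold by (simp only: sum_distrib_left mult.assoc)
  then show ?thesis using xs approx unfolding trig[symmetric] by (intro exI[of _ xs]) simp
qed

lemma trig_AP_on: "snd ` set xs \<subseteq> D \<Longrightarrow> trig xs \<in> AP_on D"
  using bohr_coeff_trig_outside[of _ xs] unfolding AP_on_def bohr_spectrum_def by (blast intro: trig_AP)

lemma AP_on_limitI:
  assumes "\<And>e. e > 0 \<Longrightarrow> \<exists>g\<in>AP_on D. \<forall>x. cmod (f x - g x) \<le> e"
  shows "f \<in> AP_on D"
proof -
  have "\<exists>g\<in>AP_on D. \<forall>x. cmod (f x - g x) \<le> inverse (real (Suc n))" for n by (rule assms) simp
  then obtain g where g: "\<And>n. g n \<in> AP_on D" "\<And>n x. cmod (f x - g n x) \<le> inverse (real (Suc n))" by metis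
  have "uniform_limit UNIV g f sequentially"
    by (rule uniform_limit_inverse_Suc) (rule g(2))
  then have f: "f \<in> AP" by (rule AP_closed[rotated]) (use g(1) in \<open>auto simp: AP_on_def\<close>)
  have "bohr_coeff f l = 0" if l: "l \<notin> D" for l
  proof (rule ccontr)
    assume ne: "bohr_coeff f l \<noteq> 0"
    then obtain h where h: "h \<in> AP_on D" "\<And>x. cmod (f x - h x) \<le> cmod (bohr_coeff f l) / 2"
      using assms[of "cmod (bohr_coeff f l) / 2"] by (metis half_gt_zero zero_less_norm_iff)
    have hAP: "h \<in> AP" and "bohr_coeff h l = 0" using h(1) l by (auto simp: AP_on_def bohr_spectrum_def)
    then have "bohr_coeff (\<lambda>x. f x - h x) l = bohr_coeff f l" by (simp add: bohr_coeff_diff f)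
    then show False using bohr_coeff_bound[OF AP_diff[OF f hAP] h(2), of l] ne by simp
  qed
  then show ?thesis using f by (auto simp: AP_on_def bohr_spectrum_def)
qed

lemma AP_on_bounded: "f \<in> AP_on D \<Longrightarrow> \<exists>B>0. \<forall>x. cmod (f x) \<le> B"
  using AP_bounded by (auto simp: AP_on_def)

lemma AP_on_mono: "D \<subseteq> E \<Longrightarrow> AP_on D \<subseteq> AP_on E"
  by (auto simp: AP_on_def)

lemma AP_on_e_fun: "l \<in> D \<Longrightarrow> e_fun l \<in> AP_on D"
  by (auto simp: AP_on_def AP_e bohr_spectrum_def bohr_coeff_e_fun)

lemma AP_on_scale: "f \<in> AP_on D \<Longrightarrow> (\<lambda>x. c * f x) \<in> AP_on D"
  by (auto simp: AP_on_def AP_scale bohr_spectrum_def bohr_coeff_scale)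

lemma AP_on_add: "f \<in> AP_on D \<Longrightarrow> g \<in> AP_on D \<Longrightarrow> f + g \<in> AP_on D"
proof -
  assume fg: "f \<in> AP_on D" "g \<in> AP_on D"
  then have "f \<in> AP" "g \<in> AP" and "\<And>l. l \<notin> D \<Longrightarrow> bohr_coeff f l = 0 \<and> bohr_coeff g l = 0"
    by (auto simp: AP_on_def bohr_spectrum_def)
  then have "f + g \<in> AP" "\<And>l. l \<notin> D \<Longrightarrow> bohr_coeff (f + g) l = 0"
    using AP_add[of f g] bohr_coeff_add[of f g] by (simp_all only: add_0_left simp_thms)
  then show "f + g \<in> AP_on D" unfolding AP_on_def bohr_spectrum_def by blast
qed

definition add_submonoid :: "'a :: monoid_add set \<Rightarrow> bool" where
  "add_submonoid D \<longleftrightarrow> 0 \<in> D \<and> (\<forall>l\<in>D. \<forall>m\<in>D. l + m \<in> D)"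

context
  fixes D :: "(real ^ 'k) set"
  assumes D: "add_submonoid D"
begin

lemma AP_on_const: "(\<lambda>x. c) \<in> AP_on D"
  using AP_on_scale[OF AP_on_e_fun, of 0 D c] D by (simp add: e_fun_zero add_submonoid_def)

lemma AP_on_0: "0 \<in> AP_on D" and AP_on_1: "1 \<in> AP_on D"
  unfolding zero_fun_def one_fun_def by (rule AP_on_const)+

text \<open>
  Bohr coefficients of a product are not directly accessible, but those of a product of trigonometric
  polynomials are supported on sums of exponents, and such products approximate \<open>f * g\<close>.
\<close>
lemma AP_on_mult:
  assumes f: "f \<in> AP_on D" and g: "g \<in> AP_on D"
  shows "f * g \<in> AP_on D"
proof (rule AP_on_limitI)
  fix e :: real assume e: "e > 0"
  obtain B where B: "B > 0" "\<And>x. cmod (f x) \<le> B" using AP_on_bounded[OF f] by blast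
  obtain ys where ys: "snd ` set ys \<subseteq> D" "\<And>x. cmod (g x - trig ys x) \<le> e / (2 * B)"
    using AP_on_trig_approx[OF g, of "e / (2 * B)"] e B(1) by (metis divide_pos_pos mult_pos_pos zero_less_numeral)
  obtain C where C: "C > 0" "\<And>x. cmod (trig ys x) \<le> C" using AP_bounded[OF trig_AP] by metis
  obtain xs where xs: "snd ` set xs \<subseteq> D" "\<And>x. cmod (f x - trig xs x) \<le> e / (2 * C)"
    using AP_on_trig_approx[OF f, of "e / (2 * C)"] e C(1) by (metis divide_pos_pos mult_pos_pos zero_less_numeral)
  let ?zs = "concat (map (\<lambda>(c, l). map (\<lambda>(d, m). (c * d, l + m)) ys) xs)"
  have "snd ` set ?zs \<subseteq> D" using xs(1) ys(1) D unfolding add_submonoid_def by force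
  moreover have "cmod ((f * g) x - trig ?zs x) \<le> e" for x
    using norm_product_approx[OF B C xs(2) ys(2)] by (simp add: trig_mult)
  ultimately show "\<exists>h\<in>AP_on D. \<forall>x. cmod ((f * g) x - h x) \<le> e" using trig_AP_on by blast
qed

lemma AP_on_sum: "(\<And>i. i \<in> I \<Longrightarrow> f i \<in> AP_on D) \<Longrightarrow> sum f I \<in> AP_on D"
  by (induction I rule: infinite_finite_induct) (simp_all only: sum.infinite sum.empty sum.insert AP_on_0 AP_on_add insert_iff simp_thms)

lemma AP_on_prod: "(\<And>i. i \<in> I \<Longrightarrow> f i \<in> AP_on D) \<Longrightarrow> prod f I \<in> AP_on D"
  by (induction I rule: infinite_finite_induct) (simp_all only: prod.infinite prod.empty prod.insert AP_on_1 AP_on_mult insert_iff simp_thms)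

lemma AP_on_power: "f \<in> AP_on D \<Longrightarrow> f ^ k \<in> AP_on D"
  by (induction k) (simp_all only: power_0 power_Suc AP_on_1 AP_on_mult)

lemma AP_on_uminus: "f \<in> AP_on D \<Longrightarrow> - f \<in> AP_on D"
  using AP_on_scale[of f D "-1"] by (simp add: fun_Compl_def)

lemma AP_on_minus: "f \<in> AP_on D \<Longrightarrow> g \<in> AP_on D \<Longrightarrow> f - g \<in> AP_on D"
  using AP_on_add[OF _ AP_on_uminus, of f g] by (simp only: diff_conv_add_uminus)

text \<open>
  The geometric series in \<open>1 - f\<close> converges uniformly.
\<close>
lemma AP_on_inverse:
  assumes f: "f \<in> AP_on D" and near: "\<And>x. cmod (f x - 1) \<le> 1 / 2"
  shows "(\<lambda>x. inverse (f x)) \<in> AP_on D"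
proof (rule AP_on_limitI)
  fix e :: real assume "e > 0"
  then obtain N where N: "(1 / 2 :: real) ^ N < e / 2"
    using real_arch_pow_inv[of "e / 2" "1 / 2"] by auto
  let ?g = "\<Sum>k<N. (1 - f) ^ k"
  have "?g \<in> AP_on D" by (intro AP_on_sum AP_on_power AP_on_minus AP_on_1 f)
  moreover have "cmod (inverse (f x) - ?g x) \<le> e" for x
  proof -
    have gx: "?g x = (\<Sum>k<N. (1 - f x) ^ k)"
    proof -
      have "(h ^ k) x = h x ^ k" for h :: "real ^ 'k \<Rightarrow> complex" and k by (induction k) auto
      moreover have "(\<Sum>k\<in>I. F k) x = (\<Sum>k\<in>I. F k x)" for F :: "nat \<Rightarrow> real ^ 'k \<Rightarrow> complex" and I
        by (induction I rule: infinite_finite_induct) auto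
      ultimately show ?thesis by simp
    qed
    have "cmod (f x) \<ge> 1 / 2" using near[of x] norm_triangle_ineq4[of "f x" "f x - 1"] by simp
    then have fx: "f x \<noteq> 0" "cmod (inverse (f x)) \<le> 2"
      using le_imp_inverse_le[of "1 / 2" "cmod (f x)"] by (auto simp: norm_inverse)
    have "f x * (\<Sum>k<N. (1 - f x) ^ k) = 1 - (1 - f x) ^ N"
      using one_diff_power_eq[of "1 - f x" N] by simp
    then have "inverse (f x) - ?g x = inverse (f x) * (1 - f x) ^ N"
      using fx unfolding gx by (simp add: field_simps)
    also have "cmod \<dots> \<le> 2 * (1 / 2) ^ N"
      unfolding norm_mult norm_power using near[of x] fx
      by (intro mult_mono power_mono) (auto simp: norm_minus_commute)
    also have "\<dots> \<le> e" using N by simp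
    finally show ?thesis .
  qed
  ultimately show "\<exists>g\<in>AP_on D. \<forall>x. cmod (inverse (f x) - g x) \<le> e" by blast
qed

end

section \<open>Matrices over the algebra\<close>

lemma AP_mat_iff: "M \<in> AP_mat D m n \<longleftrightarrow> M \<in> carrier_mat m n \<and> (\<forall>i<m. \<forall>j<n. M $$ (i, j) \<in> AP_on D)"
  unfolding AP_mat_def by (auto dest!: elements_matD)

lemma AP_mat_carrier: "M \<in> AP_mat D m n \<Longrightarrow> M \<in> carrier_mat m n"
  by (simp add: AP_mat_iff)

lemma AP_mat_entry: "M \<in> AP_mat D m n \<Longrightarrow> i < m \<Longrightarrow> j < n \<Longrightarrow> M $$ (i, j) \<in> AP_on D"
  by (simp add: AP_mat_iff)

lemma AP_mat_mono: "D \<subseteq> E \<Longrightarrow> AP_mat D m n \<subseteq> AP_mat E m n"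
  using AP_on_mono[of D E] by (auto simp: AP_mat_iff subset_iff)

lemma AP_mat_transpose: "M \<in> AP_mat D m n \<Longrightarrow> transpose_mat M \<in> AP_mat D n m"
  by (auto simp: AP_mat_iff)

lemma AP_mat_add: "M \<in> AP_mat D m n \<Longrightarrow> N \<in> AP_mat D m n \<Longrightarrow> M + N \<in> AP_mat D m n"
  by (auto simp: AP_mat_iff intro!: AP_on_add)

context
  fixes D :: "(real ^ 'k) set"
  assumes D: "add_submonoid D"
begin

lemma AP_mat_one: "1\<^sub>m n \<in> AP_mat D n n"
  using AP_on_0[OF D] AP_on_1[OF D] by (auto simp: AP_mat_iff one_mat_def)

lemma AP_mat_mult: "M \<in> AP_mat D m n \<Longrightarrow> N \<in> AP_mat D n p \<Longrightarrow> M * N \<in> AP_mat D m p"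
  by (auto simp: AP_mat_iff scalar_prod_def intro!: AP_on_sum[OF D] AP_on_mult[OF D])

lemma AP_mat_minus: "M \<in> AP_mat D m n \<Longrightarrow> N \<in> AP_mat D m n \<Longrightarrow> M - N \<in> AP_mat D m n"
  by (auto simp: AP_mat_iff intro!: AP_on_minus[OF D])

lemma AP_on_det:
  assumes "M \<in> AP_mat D n n" shows "Determinant.det M \<in> AP_on D"
proof -
  have "signof p \<in> AP_on D" for p :: "nat \<Rightarrow> nat"
    using AP_on_1[OF D] AP_on_uminus[OF D AP_on_1[OF D]] by (simp add: sign_def)
  then show ?thesis
    unfolding det_def'[OF AP_mat_carrier[OF assms]]
    by (intro AP_on_sum[OF D] AP_on_mult[OF D] AP_on_prod[OF D] AP_mat_entry[OF assms])
       (auto simp: permutes_def)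
qed

text \<open>
  Cramer's rule reduces the inversion of matrices over the algebra to the inversion of their
  determinants.
\<close>
lemma AP_mat_adj:
  assumes "M \<in> AP_mat D n n" shows "adj_mat M \<in> AP_mat D n n"
proof -
  have "cofactor M j i \<in> AP_on D" if "i < n" "j < n" for i j
  proof -
    have "mat_delete M j i \<in> AP_mat D (n - 1) (n - 1)"
      using assms that by (auto simp: AP_mat_iff mat_delete_def)
    moreover have "(- 1) ^ (j + i) \<in> AP_on D"
      by (intro AP_on_power[OF D] AP_on_uminus[OF D AP_on_1[OF D]])
    ultimately show ?thesis unfolding cofactor_def by (intro AP_on_mult[OF D] AP_on_det)
  qed
  then show ?thesis using assms unfolding adj_mat_def by (auto simp: AP_mat_iff)
qed

end

text \<open>
  The determinant is a polynomial in the entries; continuity at the identity is used through sequences.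
\<close>
lemma det_near_one:
  "\<exists>\<epsilon>>0. \<forall>X\<in>carrier_mat n n. (\<forall>i<n. \<forall>j<n. cmod (X $$ (i, j) - 1\<^sub>m n $$ (i, j)) \<le> \<epsilon>)
     \<longrightarrow> cmod (Determinant.det X - 1) \<le> 1 / 2"
proof (rule ccontr)
  assume neg: "\<not> ?thesis"
  have "\<exists>X\<in>carrier_mat n n. (\<forall>i<n. \<forall>j<n. cmod (X $$ (i, j) - 1\<^sub>m n $$ (i, j)) \<le> inverse (real (Suc k)))
      \<and> cmod (Determinant.det X - 1) > 1 / 2" for k
  proof -
    have "inverse (real (Suc k)) > 0" by simp
    then show ?thesis using neg by (meson not_le)
  qed
  then obtain X where X: "\<And>k. X k \<in> carrier_mat n n"
      "\<And>k i j. i < n \<Longrightarrow> j < n \<Longrightarrow> cmod (X k $$ (i, j) - 1\<^sub>m n $$ (i, j)) \<le> inverse (real (Suc k))"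
      "\<And>k. cmod (Determinant.det (X k) - 1) > 1 / 2" by metis
  have lim: "(\<lambda>k. X k $$ (i, j)) \<longlonglongrightarrow> 1\<^sub>m n $$ (i, j)" if "i < n" "j < n" for i j
  proof -
    have "(\<lambda>k. X k $$ (i, j) - 1\<^sub>m n $$ (i, j)) \<longlonglongrightarrow> 0"
      by (rule Lim_null_comparison[OF _ LIMSEQ_inverse_real_of_nat]) (use X(2) that in \<open>auto intro: always_eventually\<close>)
    then show ?thesis by (simp only: LIM_zero_iff)
  qed
  have "(\<lambda>k. \<Sum>p | p permutes {0..<n}. signof p * (\<Prod>i = 0..<n. X k $$ (i, p i)))
      \<longlonglongrightarrow> (\<Sum>p | p permutes {0..<n}. signof p * (\<Prod>i = 0..<n. 1\<^sub>m n $$ (i, p i)))"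
  proof (intro tendsto_sum tendsto_mult tendsto_const tendsto_prod)
    fix p i assume "p \<in> {p. p permutes {0..<n}}" "i \<in> {0..<n}"
    then have "i < n" "p i < n" using permutes_in_image[of p "{0..<n}" i] by auto
    then show "(\<lambda>k. X k $$ (i, p i)) \<longlonglongrightarrow> 1\<^sub>m n $$ (i, p i)" by (rule lim)
  qed
  then have "(\<lambda>k. Determinant.det (X k)) \<longlonglongrightarrow> Determinant.det (1\<^sub>m n :: complex mat)"
    by (simp only: det_def'[OF X(1)] det_def'[OF one_carrier_mat])
  then have "(\<lambda>k. cmod (Determinant.det (X k) - 1)) \<longlonglongrightarrow> cmod (1 - 1)"
    by (intro tendsto_intros) simp
  then have "eventually (\<lambda>k. cmod (Determinant.det (X k) - 1) < 1 / 2) sequentially"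
    by (intro order_tendstoD) auto
  then obtain k where "cmod (Determinant.det (X k) - 1) < 1 / 2" by (auto simp: eventually_sequentially)
  then show False using X(3)[of k] by simp
qed

lemma det_fun_apply:
  fixes X :: "('a \<Rightarrow> complex) mat"
  shows "Determinant.det (map_mat (\<lambda>f. f x) X) = Determinant.det X x"
proof -
  interpret comm_ring_hom "\<lambda>f :: 'a \<Rightarrow> complex. f x" by standard auto
  show ?thesis by (rule hom_det)
qed

definition invertible_over :: "(real ^ 'k) set \<Rightarrow> nat \<Rightarrow> (real ^ 'k \<Rightarrow> complex) mat \<Rightarrow> bool" where
  "invertible_over D n W \<longleftrightarrow> W \<in> AP_mat D n n \<and> (\<exists>V\<in>AP_mat D n n. W * V = 1\<^sub>m n \<and> V * W = 1\<^sub>m n)"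

lemma invertible_over_near_one:
  assumes D: "add_submonoid (D :: (real ^ 'k) set)"
  shows "\<exists>\<epsilon>>0. \<forall>X\<in>AP_mat D n n. (\<forall>i<n. \<forall>j<n. \<forall>x. cmod ((X $$ (i, j)) x - 1\<^sub>m n $$ (i, j)) \<le> \<epsilon>)
     \<longrightarrow> invertible_over D n X"
proof -
  obtain \<epsilon> where e: "\<epsilon> > 0" and det: "\<And>X. X \<in> carrier_mat n n
      \<Longrightarrow> (\<forall>i<n. \<forall>j<n. cmod (X $$ (i, j) - 1\<^sub>m n $$ (i, j)) \<le> \<epsilon>) \<Longrightarrow> cmod (Determinant.det X - 1) \<le> 1 / 2"
    using det_near_one[of n] by blast
  have main: "invertible_over D n X" if X: "X \<in> AP_mat D n n"
    and near: "\<And>i j x. i < n \<Longrightarrow> j < n \<Longrightarrow> cmod ((X $$ (i, j)) x - 1\<^sub>m n $$ (i, j)) \<le> \<epsilon>" for X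
  proof -
    have Xc: "X \<in> carrier_mat n n" using X by (rule AP_mat_carrier)
    let ?d = "Determinant.det X"
    have "cmod (Determinant.det (map_mat (\<lambda>f. f x) X) - 1) \<le> 1 / 2" for x
      by (rule det) (use Xc near in auto)
    then have dx: "cmod (?d x - 1) \<le> 1 / 2" for x by (simp only: det_fun_apply)
    have "?d x \<noteq> 0" for x using dx[of x] by auto
    define c where "c = (\<lambda>x. inverse (?d x))"
    have c: "c \<in> AP_on D" unfolding c_def by (rule AP_on_inverse[OF D AP_on_det[OF D X] dx])
    have cd: "c * ?d = 1" using \<open>\<And>x. ?d x \<noteq> 0\<close> by (simp add: c_def fun_eq_iff)
    have adj: "adj_mat X \<in> AP_mat D n n" by (rule AP_mat_adj[OF D X])
    have "c \<cdot>\<^sub>m adj_mat X \<in> AP_mat D n n"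
      using adj by (auto simp: AP_mat_iff intro!: AP_on_mult[OF D] c)
    moreover have "X * (c \<cdot>\<^sub>m adj_mat X) = 1\<^sub>m n" "c \<cdot>\<^sub>m adj_mat X * X = 1\<^sub>m n"
      using adj_mat[OF Xc] Xc AP_mat_carrier[OF adj]
      by (simp_all add: mult_smult_distrib[of _ n n] mult_smult_assoc_mat[of _ n n])
         (auto simp: one_mat_def cd intro!: eq_matI)
    ultimately show ?thesis using X unfolding invertible_over_def by blast
  qed
  show ?thesis
    by (intro exI[of _ \<epsilon>] conjI ballI impI e main) simp_all
qed

lemma append_rows_index:
  assumes "A \<in> carrier_mat m n" "B \<in> carrier_mat k n" "i < m + k" "j < n"
  shows "(A @\<^sub>r B) $$ (i, j) = (if i < m then A $$ (i, j) else B $$ (i - m, j))"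
  using assms by (auto simp: append_rows_def)

lemma append_rows_mult:
  assumes "A \<in> carrier_mat m n" "B \<in> carrier_mat k n" "W \<in> carrier_mat n p"
  shows "(A @\<^sub>r B) * W = (A * W) @\<^sub>r (B * W)"
proof (rule eq_matI)
  have AB: "A @\<^sub>r B \<in> carrier_mat (m + k) n" using assms by simp
  have ABW: "(A * W) @\<^sub>r (B * W) \<in> carrier_mat (m + k) p" using assms by simp
  show "dim_row ((A @\<^sub>r B) * W) = dim_row ((A * W) @\<^sub>r (B * W))"
    "dim_col ((A @\<^sub>r B) * W) = dim_col ((A * W) @\<^sub>r (B * W))"
    by (simp_all only: carrier_matD[OF ABW] carrier_matD[OF mult_carrier_mat[OF AB assms(3)]])
  fix i j assume "i < dim_row ((A * W) @\<^sub>r (B * W))" "j < dim_col ((A * W) @\<^sub>r (B * W))"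
  then have ij: "i < m + k" "j < p" using ABW by auto
  have "((A @\<^sub>r B) * W) $$ (i, j) = (\<Sum>l\<in>{0..<n}. (A @\<^sub>r B) $$ (i, l) * W $$ (l, j))"
    using AB assms(3) ij by (auto simp: scalar_prod_def)
  also have "\<dots> = (\<Sum>l\<in>{0..<n}. (if i < m then A $$ (i, l) else B $$ (i - m, l)) * W $$ (l, j))"
    using ij by (intro sum.cong refl) (simp add: append_rows_index[OF assms(1,2)])
  also have "\<dots> = ((A * W) @\<^sub>r (B * W)) $$ (i, j)"
    using ij assms by (subst append_rows_index[of _ m p _ k]) (auto simp: scalar_prod_def)
  finally show "((A @\<^sub>r B) * W) $$ (i, j) = ((A * W) @\<^sub>r (B * W)) $$ (i, j)" .
qed

lemma AP_mat_append_rows: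
  "A \<in> AP_mat D m n \<Longrightarrow> B \<in> AP_mat D k n \<Longrightarrow> A @\<^sub>r B \<in> AP_mat D (m + k) n"
  by (auto simp: AP_mat_iff append_rows_index)

text \<open>
  A matrix is completable if rows over the algebra can be adjoined below it to give an invertible square
  matrix. The natural number subtraction \<open>n - m\<close> is meaningful for \<open>m \<le> n\<close> only.
\<close>
definition completable :: "(real ^ 'k) set \<Rightarrow> nat \<Rightarrow> nat \<Rightarrow> (real ^ 'k \<Rightarrow> complex) mat \<Rightarrow> bool" where
  "completable D m n B \<longleftrightarrow> (\<exists>C\<in>AP_mat D (n - m) n. invertible_over D n (B @\<^sub>r C))"

lemma invertible_over_mult:
  assumes D: "add_submonoid D" and X: "invertible_over D n X" and Y: "invertible_over D n Y"
  shows "invertible_over D n (X * Y)"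
proof -
  obtain V where V: "V \<in> AP_mat D n n" "X * V = 1\<^sub>m n" "V * X = 1\<^sub>m n"
    using X by (auto simp: invertible_over_def)
  obtain W where W: "W \<in> AP_mat D n n" "Y * W = 1\<^sub>m n" "W * Y = 1\<^sub>m n"
    using Y by (auto simp: invertible_over_def)
  have XY: "X \<in> AP_mat D n n" "Y \<in> AP_mat D n n" using X Y by (auto simp: invertible_over_def)
  note c = AP_mat_carrier[OF XY(1)] AP_mat_carrier[OF XY(2)] AP_mat_carrier[OF V(1)] AP_mat_carrier[OF W(1)]
  have "(X * Y) * (W * V) = X * (Y * W) * V" "(W * V) * (X * Y) = W * (V * X) * Y"
    using c by (simp_all add: assoc_mult_mat[of _ n n _ n _ n])
  then have "(X * Y) * (W * V) = 1\<^sub>m n" "(W * V) * (X * Y) = 1\<^sub>m n"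
    using c V W by simp_all
  then show ?thesis unfolding invertible_over_def using AP_mat_mult[OF D] XY V(1) W(1) by blast
qed

text \<open>
  The invertible matrix with upper part \<open>B\<close> is multiplied by \<open>W\<close> as a whole.
\<close>
lemma completable_mult:
  assumes D: "add_submonoid D" and B: "B \<in> AP_mat D m n" and W: "invertible_over D n W"
    and compl: "completable D m n B"
  shows "completable D m n (B * W)"
proof -
  obtain C where C: "C \<in> AP_mat D (n - m) n" "invertible_over D n (B @\<^sub>r C)"
    using compl by (auto simp: completable_def)
  have W': "W \<in> AP_mat D n n" using W by (simp add: invertible_over_def)
  have "(B @\<^sub>r C) * W = (B * W) @\<^sub>r (C * W)"
    by (rule append_rows_mult) (use B C W' in \<open>auto intro: AP_mat_carrier\<close>)
  then show ?thesis
    using invertible_over_mult[OF D C(2) W] AP_mat_mult[OF D C(1) W'] unfolding completable_def by auto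
qed

text \<open>
  The orbits of right multiplication by invertible matrices. Completability is constant on them
  (\<open>completable_mult\<close>), and they are open among right invertible matrices (\<open>col_equiv_near\<close>).
\<close>
definition col_equiv :: "(real ^ 'k) set \<Rightarrow> nat \<Rightarrow> (real ^ 'k \<Rightarrow> complex) mat \<Rightarrow> (real ^ 'k \<Rightarrow> complex) mat \<Rightarrow> bool" where
  "col_equiv D n A B \<longleftrightarrow> (\<exists>W. invertible_over D n W \<and> B = A * W)"

lemma col_equiv_sym:
  assumes "A \<in> carrier_mat m n" "col_equiv D n A B"
  shows "col_equiv D n B A"
proof -
  obtain W V where W: "W \<in> AP_mat D n n" "V \<in> AP_mat D n n" "W * V = 1\<^sub>m n" "V * W = 1\<^sub>m n" "B = A * W"
    using assms(2) by (auto simp: col_equiv_def invertible_over_def)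
  have "B * V = A * (W * V)" unfolding W(5)
    by (rule assoc_mult_mat) (use assms W in \<open>auto intro: AP_mat_carrier\<close>)
  then have "A = B * V" using assms W by simp
  then show ?thesis using W unfolding col_equiv_def invertible_over_def by blast
qed

lemma col_equiv_trans:
  assumes D: "add_submonoid D" and A: "A \<in> carrier_mat m n" "col_equiv D n A B" "col_equiv D n B C"
  shows "col_equiv D n A C"
proof -
  obtain W V where W: "invertible_over D n W" "B = A * W" and V: "invertible_over D n V" "C = B * V"
    using A by (auto simp: col_equiv_def)
  have "C = A * (W * V)" unfolding W(2) V(2)
    by (rule assoc_mult_mat) (use A W V in \<open>auto intro: AP_mat_carrier simp: invertible_over_def\<close>)
  then show ?thesis using invertible_over_mult[OF D W(1) V(1)] unfolding col_equiv_def by blast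
qed

lemma completable_col_equiv:
  assumes "add_submonoid D" "A \<in> AP_mat D m n" "col_equiv D n A B" "completable D m n A"
  shows "completable D m n B"
  using assms completable_mult by (auto simp: col_equiv_def)

lemma AP_mat_bounded:
  assumes "M \<in> AP_mat D m n"
  shows "\<exists>C>0. \<forall>i<m. \<forall>j<n. \<forall>x. cmod ((M $$ (i, j)) x) \<le> C"
proof -
  have "\<forall>i\<in>{..<m}. \<forall>j\<in>{..<n}. \<exists>C>0. \<forall>x. cmod ((M $$ (i, j)) x) \<le> C"
    using AP_on_bounded AP_mat_entry[OF assms] by blast
  then obtain C where C: "\<And>i j. i < m \<Longrightarrow> j < n \<Longrightarrow> C i j > 0 \<and> (\<forall>x. cmod ((M $$ (i, j)) x) \<le> C i j)"
    by (metis lessThan_iff)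
  let ?C = "1 + (\<Sum>(i, j)\<in>{..<m} \<times> {..<n}. \<bar>C i j\<bar>)"
  have "cmod ((M $$ (i, j)) x) \<le> ?C" if "i < m" "j < n" for i j x
  proof -
    have "cmod ((M $$ (i, j)) x) \<le> C i j" using C that by blast
    also have "\<dots> \<le> (\<lambda>(i, j). \<bar>C i j\<bar>) (i, j)" by simp
    also have "\<dots> \<le> (\<Sum>(i, j)\<in>{..<m} \<times> {..<n}. \<bar>C i j\<bar>)"
      by (rule member_le_sum) (use that in auto)
    finally show ?thesis by simp
  qed
  moreover have "?C > 0" by (intro add_pos_nonneg sum_nonneg) auto
  ultimately show ?thesis by blast
qed

lemma sum_fun_apply: "(\<Sum>i\<in>I. f i) x = (\<Sum>i\<in>I. f i x)"
  by (induction I rule: infinite_finite_induct) auto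

lemma mat_mult_entry_apply:
  assumes "A \<in> carrier_mat m n" "B \<in> carrier_mat n p" "i < m" "j < p"
  shows "((A * B) $$ (i, j)) x = (\<Sum>l<n. (A $$ (i, l)) x * (B $$ (l, j)) x)"
  using assms by (auto simp: scalar_prod_def sum_fun_apply atLeast0LessThan)

text \<open>
  Since \<open>B * R = 1\<close>, the matrix \<open>W = 1 + R * (B' - B)\<close> satisfies \<open>B * W = B'\<close>; it is close to the identity
  because the entries of \<open>R\<close> are bounded.
\<close>
lemma col_equiv_near:
  assumes D: "add_submonoid D" and B: "B \<in> AP_mat D m n" and R: "R \<in> AP_mat D n m" and BR: "B * R = 1\<^sub>m m"
  shows "\<exists>\<delta>>0. \<forall>B'\<in>AP_mat D m n. (\<forall>i<m. \<forall>j<n. \<forall>x. cmod ((B' $$ (i, j)) x - (B $$ (i, j)) x) \<le> \<delta>)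
     \<longrightarrow> col_equiv D n B B'"
proof -
  obtain \<epsilon> where e: "\<epsilon> > 0" and inv: "\<And>X. X \<in> AP_mat D n n
     \<Longrightarrow> (\<forall>i<n. \<forall>j<n. \<forall>x. cmod ((X $$ (i, j)) x - 1\<^sub>m n $$ (i, j)) \<le> \<epsilon>) \<Longrightarrow> invertible_over D n X"
    using invertible_over_near_one[OF D, of n] by blast
  obtain C where C: "C > 0" "\<And>i j x. i < n \<Longrightarrow> j < m \<Longrightarrow> cmod ((R $$ (i, j)) x) \<le> C"
    using AP_mat_bounded[OF R] by blast
  define \<delta> where "\<delta> = \<epsilon> / (real m * C + 1)"
  have mC: "real m * C + 1 > 0" using C by (intro add_nonneg_pos) auto
  then have d: "\<delta> > 0" using e by (simp add: \<delta>_def)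
  have main: "col_equiv D n B B'" if B': "B' \<in> AP_mat D m n"
    and near: "\<And>i j x. i < m \<Longrightarrow> j < n \<Longrightarrow> cmod ((B' $$ (i, j)) x - (B $$ (i, j)) x) \<le> \<delta>" for B'
  proof -
    let ?W = "1\<^sub>m n + R * (B' - B)"
    note c = AP_mat_carrier[OF B] AP_mat_carrier[OF R] AP_mat_carrier[OF B']
    have W: "?W \<in> AP_mat D n n" by (rule AP_mat_add[OF AP_mat_one[OF D] AP_mat_mult[OF D R AP_mat_minus[OF D B' B]]])
    have "cmod ((?W $$ (i, j)) x - 1\<^sub>m n $$ (i, j)) \<le> \<epsilon>" if ij: "i < n" "j < n" for i j x
    proof -
      have "(?W $$ (i, j)) x - 1\<^sub>m n $$ (i, j) = ((R * (B' - B)) $$ (i, j)) x"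
        using c ij by simp
      also have "\<dots> = (\<Sum>l<m. (R $$ (i, l)) x * ((B' $$ (l, j)) x - (B $$ (l, j)) x))"
        using c ij by (subst mat_mult_entry_apply[of _ n m _ n]) auto
      also have "cmod \<dots> \<le> (\<Sum>l<m. C * \<delta>)"
        by (rule sum_norm_le) (unfold norm_mult, rule mult_mono, use C near ij in auto)
      also have "\<dots> \<le> (real m * C + 1) * \<delta>" using d by (simp add: algebra_simps)
      also have "\<dots> = \<epsilon>" using mC by (simp add: \<delta>_def)
      finally show ?thesis .
    qed
    then have "invertible_over D n ?W" by (intro inv W) blast
    moreover have "B' = B * ?W"
    proof -
      have "B * ?W = B * 1\<^sub>m n + B * (R * (B' - B))"
        using c by (intro mult_add_distrib_mat[of _ m n _ n]) auto
      also have "B * (R * (B' - B)) = (B * R) * (B' - B)"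
        using c by (intro assoc_mult_mat[symmetric]) auto
      also have "\<dots> = B' - B" using c BR by simp
      also have "B * 1\<^sub>m n + (B' - B) = B'" using c by (intro eq_matI) auto
      finally show ?thesis by simp
    qed
    ultimately show ?thesis unfolding col_equiv_def by blast
  qed
  show ?thesis
    by (intro exI[of _ \<delta>] conjI ballI impI d main) simp_all
qed

section \<open>Completion of constant matrices\<close>

text \<open>
  Padding with zero rows gives a square matrix of determinant zero.
\<close>
lemma exists_kernel_vec:
  fixes K :: "'a :: field mat"
  assumes K: "K \<in> carrier_mat m n" and mn: "m < n"
  shows "\<exists>v\<in>carrier_vec n. v \<noteq> 0\<^sub>v n \<and> K *\<^sub>v v = 0\<^sub>v m"
proof -
  let ?Z = "K @\<^sub>r 0\<^sub>m (n - m) n"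
  have Z: "?Z \<in> carrier_mat n n" using carrier_append_rows[OF K zero_carrier_mat, of "n - m"] mn by simp
  have "row ?Z m = 0\<^sub>v n"
    using mn Z by (intro eq_vecI) (auto simp: append_rows_index[OF K zero_carrier_mat])
  then have "?Z = mat\<^sub>r n n (\<lambda>i. if i = m then 0\<^sub>v n else row ?Z i)"
    using Z by (intro eq_rowI) auto
  moreover have "Determinant.det (mat\<^sub>r n n (\<lambda>i. if i = m then 0\<^sub>v n else row ?Z i)) = 0"
    by (rule det_row_0[OF mn]) (use Z in auto)
  ultimately have "Determinant.det ?Z = 0" by simp
  then obtain v where v: "v \<in> carrier_vec n" "v \<noteq> 0\<^sub>v n" "?Z *\<^sub>v v = 0\<^sub>v n"
    using det_0_iff_vec_prod_zero[OF Z] by auto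
  have "(K *\<^sub>v v) @\<^sub>v (0\<^sub>m (n - m) n *\<^sub>v v) = 0\<^sub>v n"
    using mat_mult_append[OF K zero_carrier_mat v(1), of "n - m"] v(3) by simp
  then have "(K *\<^sub>v v) $ i = 0" if "i < m" for i
    using that K mn by (metis carrier_matD(1) dim_mult_mat_vec index_append_vec(1) index_zero_vec(1) less_trans trans_less_add1)
  then have "K *\<^sub>v v = 0\<^sub>v m" using K by (intro eq_vecI) auto
  then show ?thesis using v by blast
qed

text \<open>
  For a kernel vector \<open>v\<close> of \<open>K\<close>, a row \<open>c\<close> with \<open>c * v = 1\<close> and \<open>c * R = 0\<close> makes \<open>v\<close> a new last column of
  the right inverse. A row \<open>U\<close> with \<open>U * v = 1\<close> is immediate, and subtracting \<open>U * R * K\<close> achieves the second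
  condition without affecting the first.
\<close>
lemma right_invertible_add_row:
  fixes K R :: "'a :: field mat"
  assumes K: "K \<in> carrier_mat m n" and R: "R \<in> carrier_mat n m" and KR: "K * R = 1\<^sub>m m" and mn: "m < n"
  shows "\<exists>c\<in>carrier_mat 1 n. \<exists>R'\<in>carrier_mat n (Suc m). (K @\<^sub>r c) * R' = 1\<^sub>m (Suc m)"
proof -
  obtain v where v: "v \<in> carrier_vec n" "v \<noteq> 0\<^sub>v n" "K *\<^sub>v v = 0\<^sub>v m"
    using exists_kernel_vec[OF K mn] by blast
  obtain i where i: "i < n" "v $ i \<noteq> 0" using v(1,2) by (metis carrier_vecD eq_vecI index_zero_vec)
  define V where "V = mat n 1 (\<lambda>(k, _). v $ k)"
  define U where "U = mat 1 n (\<lambda>(_, k). if k = i then inverse (v $ i) else 0)"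
  define c where "c = U - U * R * K"
  have VU: "V \<in> carrier_mat n 1" "U \<in> carrier_mat 1 n" by (simp_all add: V_def U_def)
  have c: "c \<in> carrier_mat 1 n" unfolding c_def by (rule minus_carrier_mat[OF mult_carrier_mat[OF mult_carrier_mat[OF VU(2) R] K]])
  have KV: "K * V = 0\<^sub>m m 1"
  proof (rule eq_matI)
    fix k j assume kj: "k < dim_row (0\<^sub>m m 1 :: 'a mat)" "j < dim_col (0\<^sub>m m 1 :: 'a mat)"
    have "col V 0 = v" using v(1) by (auto simp: V_def)
    then have "(K * V) $$ (k, j) = (K *\<^sub>v v) $ k" using kj K VU by auto
    then show "(K * V) $$ (k, j) = 0\<^sub>m m 1 $$ (k, j)" using kj v(3) by simp
  qed (use K VU in auto)
  have UV: "U * V = 1\<^sub>m 1"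
  proof (rule eq_matI)
    fix k j assume kj: "k < dim_row (1\<^sub>m 1 :: 'a mat)" "j < dim_col (1\<^sub>m 1 :: 'a mat)"
    have "(U * V) $$ (k, j) = (\<Sum>l<n. U $$ (0, l) * V $$ (l, 0))"
      using kj VU by (simp add: scalar_prod_def atLeast0LessThan)
    also have "\<dots> = (\<Sum>l<n. if l = i then inverse (v $ i) * v $ l else 0)"
      by (intro sum.cong refl) (simp add: U_def V_def)
    also have "\<dots> = 1" using i by simp
    finally show "(U * V) $$ (k, j) = 1\<^sub>m 1 $$ (k, j)" using kj by simp
  qed (use VU in auto)
  have URK: "U * R \<in> carrier_mat 1 m" "U * R * K \<in> carrier_mat 1 n" using VU K R by auto
  have "c * V = U * V - U * R * K * V"
    unfolding c_def by (rule minus_mult_distrib_mat[OF VU(2) URK(2) VU(1)])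
  also have "U * R * K * V = U * R * (K * V)" by (rule assoc_mult_mat[OF URK(1) K VU(1)])
  also have "\<dots> = 0\<^sub>m 1 1" unfolding KV by (rule right_mult_zero_mat[OF URK(1)])
  also have "U * V - 0\<^sub>m 1 1 = 1\<^sub>m 1" unfolding UV by (intro eq_matI) auto
  finally have cV: "c * V = 1\<^sub>m 1" .
  have "c * R = U * R - U * R * K * R"
    unfolding c_def by (rule minus_mult_distrib_mat[OF VU(2) URK(2) R])
  also have "U * R * K * R = U * R * (K * R)" by (rule assoc_mult_mat[OF URK(1) K R])
  also have "\<dots> = U * R" unfolding KR by (rule right_mult_one_mat[OF URK(1)])
  also have "U * R - U * R = 0\<^sub>m 1 m" using URK(1) by (intro eq_matI) auto
  finally have cR: "c * R = 0\<^sub>m 1 m" .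
  have "(K @\<^sub>r c) * append_cols R V = four_block_mat (K * R + 0\<^sub>m m 0 * 0\<^sub>m 0 m) (K * V + 0\<^sub>m m 0 * 0\<^sub>m 0 1)
      (c * R + 0\<^sub>m 1 0 * 0\<^sub>m 0 m) (c * V + 0\<^sub>m 1 0 * 0\<^sub>m 0 1)"
    unfolding append_rows_def append_cols_def using K R c VU
    by (subst mult_four_block_mat[of _ m n _ 0 _ 1 _ _ m _ 1]) auto
  also have "\<dots> = four_block_mat (1\<^sub>m m) (0\<^sub>m m 1) (0\<^sub>m 1 m) (1\<^sub>m 1)"
    unfolding KR KV cR cV by (intro arg_cong4[where f = four_block_mat] eq_matI) auto
  also have "\<dots> = 1\<^sub>m (m + 1)" by (rule four_block_one_mat)
  finally have "(K @\<^sub>r c) * append_cols R V = 1\<^sub>m (Suc m)" by simp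
  moreover have "append_cols R V \<in> carrier_mat n (Suc m)"
    using R VU unfolding append_cols_def by auto
  ultimately show ?thesis using c by blast
qed

lemma append_rows_assoc:
  assumes "A \<in> carrier_mat a n" "B \<in> carrier_mat b n" "C \<in> carrier_mat c n"
  shows "(A @\<^sub>r B) @\<^sub>r C = A @\<^sub>r (B @\<^sub>r C)"
proof (rule eq_matI)
  have L: "(A @\<^sub>r B) @\<^sub>r C \<in> carrier_mat (a + b + c) n" and R: "A @\<^sub>r (B @\<^sub>r C) \<in> carrier_mat (a + (b + c)) n"
    using assms by (meson carrier_append_rows)+
  show "dim_row ((A @\<^sub>r B) @\<^sub>r C) = dim_row (A @\<^sub>r (B @\<^sub>r C))" "dim_col ((A @\<^sub>r B) @\<^sub>r C) = dim_col (A @\<^sub>r (B @\<^sub>r C))"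
    by (simp_all only: carrier_matD[OF L] carrier_matD[OF R] add.assoc)
  fix i j assume "i < dim_row (A @\<^sub>r (B @\<^sub>r C))" "j < dim_col (A @\<^sub>r (B @\<^sub>r C))"
  then have ij: "i < a + (b + c)" "j < n" using R by auto
  have "((A @\<^sub>r B) @\<^sub>r C) $$ (i, j) = (if i < a + b then (A @\<^sub>r B) $$ (i, j) else C $$ (i - (a + b), j))"
    using assms ij by (intro append_rows_index[of _ "a + b" n _ c]) auto
  also have "\<dots> = (if i < a then A $$ (i, j) else (B @\<^sub>r C) $$ (i - a, j))"
    using assms ij by (auto simp: append_rows_index[of _ _ n])
  also have "\<dots> = (A @\<^sub>r (B @\<^sub>r C)) $$ (i, j)"
    using assms ij by (intro append_rows_index[of _ a n _ "b + c", symmetric]) auto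
  finally show "((A @\<^sub>r B) @\<^sub>r C) $$ (i, j) = (A @\<^sub>r (B @\<^sub>r C)) $$ (i, j)" .
qed

lemma right_invertible_completion_field:
  fixes K R :: "'a :: field mat"
  assumes "K \<in> carrier_mat m n" "R \<in> carrier_mat n m" "K * R = 1\<^sub>m m" "m \<le> n"
  shows "\<exists>C\<in>carrier_mat (n - m) n. \<exists>U\<in>carrier_mat n n. (K @\<^sub>r C) * U = 1\<^sub>m n \<and> U * (K @\<^sub>r C) = 1\<^sub>m n"
  using assms
proof (induction "n - m" arbitrary: m K R)
  case 0
  then have mn: "m = n" by simp
  have "K @\<^sub>r 0\<^sub>m 0 n = K"
    using 0 mn by (intro eq_matI) (auto simp: append_rows_def)
  moreover have "R * K = 1\<^sub>m n" using mat_mult_left_right_inverse[of K n R] 0 mn by simp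
  ultimately show ?case using 0 mn by (intro bexI[of _ "0\<^sub>m 0 n"] bexI[of _ R]) auto
next
  case (Suc d)
  then have mn: "m < n" by simp
  obtain c R' where c: "c \<in> carrier_mat 1 n" and R': "R' \<in> carrier_mat n (Suc m)" "(K @\<^sub>r c) * R' = 1\<^sub>m (Suc m)"
    using right_invertible_add_row[OF Suc.prems(1-3) mn] by blast
  have Kc: "K @\<^sub>r c \<in> carrier_mat (Suc m) n" using carrier_append_rows[OF Suc.prems(1) c] by simp
  obtain C U where C: "C \<in> carrier_mat (n - Suc m) n" and U: "U \<in> carrier_mat n n"
    "((K @\<^sub>r c) @\<^sub>r C) * U = 1\<^sub>m n" "U * ((K @\<^sub>r c) @\<^sub>r C) = 1\<^sub>m n"
    using Suc.hyps(1)[OF _ Kc R' Suc_leI[OF mn]] Suc.hyps(2) by fastforce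
  have "c @\<^sub>r C \<in> carrier_mat (n - m) n" using carrier_append_rows[OF c C] Suc_diff_Suc[OF mn] by simp
  then show ?case using U unfolding append_rows_assoc[OF Suc.prems(1) c C] by blast
qed

lemma completable_constant:
  fixes D :: "(real ^ 'k) set"
  assumes D: "add_submonoid D"
    and K: "K \<in> carrier_mat m n" "R \<in> carrier_mat n m" "K * R = 1\<^sub>m m" "m \<le> n"
  shows "completable D m n (map_mat (\<lambda>c x. c) K)"
proof -
  interpret h: comm_ring_hom "\<lambda>(c :: complex) (x :: real ^ 'k). c" by standard (auto simp: fun_eq_iff)
  let ?h = "map_mat (\<lambda>(c :: complex) (x :: real ^ 'k). c)"
  obtain C U where C: "C \<in> carrier_mat (n - m) n" and U: "U \<in> carrier_mat n n"
    "(K @\<^sub>r C) * U = 1\<^sub>m n" "U * (K @\<^sub>r C) = 1\<^sub>m n"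
    using right_invertible_completion_field[OF K] by blast
  have KC: "K @\<^sub>r C \<in> carrier_mat n n" using carrier_append_rows[OF K(1) C] K(4) by simp
  have eq: "?h K @\<^sub>r ?h C = ?h (K @\<^sub>r C)"
    using K C by (intro eq_matI) (auto simp: append_rows_def)
  have const: "?h M \<in> AP_mat D a b" if "M \<in> carrier_mat a b" for M a b
    using that by (auto simp: AP_mat_iff intro: AP_on_const[OF D])
  have "?h (K @\<^sub>r C) * ?h U = 1\<^sub>m n" "?h U * ?h (K @\<^sub>r C) = 1\<^sub>m n"
    by (simp_all only: h.mat_hom_mult[OF KC U(1), symmetric] h.mat_hom_mult[OF U(1) KC, symmetric] U(2,3) h.mat_hom_one)
  then show ?thesis
    using const[OF C] const[OF KC] const[OF U(1)] unfolding completable_def invertible_over_def eq[symmetric] by blast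
qed

section \<open>A maximum principle on the half plane\<close>

text \<open>
  A Phragmen-Lindelof argument: division by \<open>1 - \<i> e z\<close>, which has modulus at least one on the closed upper
  half plane, makes the bounded function \<open>h\<close> decay at infinity, so that the maximum principle on large
  half discs applies. Then \<open>e\<close> tends to zero.
\<close>
lemma norm_le_on_upper_halfplane:
  assumes h: "h holomorphic_on UNIV" and K: "\<And>z. Im z \<ge> 0 \<Longrightarrow> cmod (h z) \<le> K"
    and M: "\<And>s. cmod (h (complex_of_real s)) \<le> M" "M > 0" and z: "Im z \<ge> 0"
  shows "cmod (h z) \<le> M"
proof -
  have damped: "cmod (h z) \<le> M * (1 + e * cmod z)" if e: "e > 0" for e
  proof -
    let ?g = "\<lambda>u. h u / (1 - \<i> * of_real e * u)"
    have den: "cmod (1 - \<i> * of_real e * u) \<ge> 1" "cmod (1 - \<i> * of_real e * u) \<ge> e * cmod u - 1"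
      if "Im u \<ge> 0" for u
    proof -
      have "1 \<le> Re (1 - \<i> * of_real e * u)" using that e by simp
      then show "cmod (1 - \<i> * of_real e * u) \<ge> 1" using complex_Re_le_cmod order_trans by blast
      have "cmod (\<i> * of_real e * u) = e * cmod u" using e by (simp add: norm_mult)
      then show "cmod (1 - \<i> * of_real e * u) \<ge> e * cmod u - 1"
        using norm_triangle_ineq3[of 1 "\<i> * of_real e * u"] by simp
    qed
    have K0: "K \<ge> 0" using K[of 0] norm_ge_zero order_trans by (metis order_refl zero_complex.sel(2))
    define R where "R = max (cmod z) ((K / M + 1) / e)"
    let ?S = "cball 0 R \<inter> {u. Im u \<ge> 0}"
    have closed: "closed ?S" by (intro closed_Int closed_cball closed_halfspace_Im_ge)
    have nz: "1 - \<i> * of_real e * u \<noteq> 0" if "u \<in> ?S" for u using den(1)[of u] that by auto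
    have "cmod (?g z) \<le> M"
    proof (rule maximum_modulus_frontier[where S = ?S and f = ?g])
      have hol: "?g holomorphic_on ?S"
        by (intro holomorphic_intros holomorphic_on_subset[OF h] nz) auto
      then show "?g holomorphic_on interior ?S" by (rule holomorphic_on_subset[OF _ interior_subset])
      show "continuous_on (closure ?S) ?g"
        unfolding closure_closed[OF closed] by (rule holomorphic_on_imp_continuous_on[OF hol])
      show "bounded ?S" by (rule bounded_subset[OF bounded_cball]) auto
      show "z \<in> ?S" using z by (auto simp: R_def)
      fix u assume u: "u \<in> frontier ?S"
      then have uS: "u \<in> ?S" using closed by (simp add: frontier_def closure_closed)
      have "ball 0 R \<inter> {u. Im u > 0} \<subseteq> interior ?S"
        by (rule interior_maximal) (auto intro: open_halfspace_Im_gt)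
      then have "Im u = 0 \<or> cmod u = R" using u uS by (force simp: frontier_def)
      then show "cmod (?g u) \<le> M"
      proof
        assume "Im u = 0"
        then have "u = complex_of_real (Re u)" by (simp add: complex_eq_iff)
        then have "cmod (h u) \<le> M" using M(1)[of "Re u"] by simp
        moreover have "cmod (1 - \<i> * of_real e * u) \<ge> 1" using den(1)[of u] uS by simp
        ultimately have "cmod (h u) / cmod (1 - \<i> * of_real e * u) \<le> M / 1"
          using M(2) by (intro frac_le) auto
        then show ?thesis by (simp add: norm_divide)
      next
        assume R: "cmod u = R"
        have "(K / M + 1) / e \<le> R" by (simp add: R_def)
        then have "K / M \<le> e * R - 1" using e by (simp add: field_simps)
        also have "\<dots> \<le> cmod (1 - \<i> * of_real e * u)" using den(2)[of u] uS R by simp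
        finally have "K \<le> M * cmod (1 - \<i> * of_real e * u)" using M(2) by (simp add: field_simps)
        moreover have "cmod (h u) \<le> K" using K uS by simp
        moreover have "cmod (1 - \<i> * of_real e * u) > 0"
        proof -
          have "cmod (1 - \<i> * of_real e * u) \<ge> 1" by (rule den(1)) (use uS in simp)
          then show ?thesis by linarith
        qed
        ultimately show ?thesis by (simp add: norm_divide divide_le_eq)
      qed
    qed
    then have "cmod (h z) \<le> M * cmod (1 - \<i> * of_real e * z)"
      using den(1)[OF z] by (simp add: norm_divide divide_le_eq split: if_splits)
    also have "\<dots> \<le> M * (1 + e * cmod z)"
      using M(2) e norm_triangle_ineq4[of 1 "\<i> * of_real e * z"] by (intro mult_left_mono) (auto simp: norm_mult)
    finally show ?thesis .
  qed
  show ?thesis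
  proof (rule field_le_epsilon)
    fix \<eta> :: real assume eta: "\<eta> > 0"
    have pos: "M * (cmod z + 1) > 0" using M(2) by (intro mult_pos_pos add_nonneg_pos) auto
    define e where "e = \<eta> / (M * (cmod z + 1))"
    have e: "e > 0" "e * (M * (cmod z + 1)) = \<eta>"
      using eta pos less_imp_neq[OF pos] unfolding e_def by (auto intro: divide_pos_pos simp del: mult_eq_0_iff)
    have "cmod (h z) \<le> M * (1 + e * cmod z)" by (rule damped[OF e(1)])
    also have "\<dots> = M + e * (M * cmod z)" by (simp add: algebra_simps)
    also have "\<dots> \<le> M + e * (M * (cmod z + 1))" using e(1) M(2) by (intro add_left_mono mult_left_mono) auto
    also have "\<dots> = M + \<eta>" by (simp only: e(2))
    finally show "cmod (h z) \<le> M + \<eta>" .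
  qed
qed

section \<open>Dilations of trigonometric polynomials\<close>

text \<open>
  This is \<open>r powr a\<close>, except that a vanishing exponent gives \<open>1\<close> also at \<open>r = 0\<close>, where \<open>powr\<close> returns \<open>0\<close>.
  Thus it is continuous in \<open>r \<in> {0..1}\<close> for every \<open>a \<ge> 0\<close>.
\<close>
definition damp :: "real \<Rightarrow> real \<Rightarrow> real" where
  "damp r a = (if a = 0 then 1 else r powr a)"

definition dilate :: "real ^ 'k \<Rightarrow> real \<Rightarrow> (complex \<times> (real ^ 'k)) list \<Rightarrow> (complex \<times> (real ^ 'k)) list" where
  "dilate w r xs = map (\<lambda>(c, l). (c * complex_of_real (damp r (inner w l)), l)) xs"

lemma dilate_Nil [simp]: "dilate w r [] = []"
  and dilate_Cons [simp]: "dilate w r ((c, l) # xs) = (c * complex_of_real (damp r (inner w l)), l) # dilate w r xs"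
  by (simp_all add: dilate_def)

lemma snd_set_dilate: "snd ` set (dilate w r xs) = snd ` set xs"
  by (force simp: dilate_def)

lemma dilate_one: "dilate w 1 xs = xs"
  by (induction xs) (auto simp: damp_def)

lemma continuous_on_damp: "a \<ge> 0 \<Longrightarrow> continuous_on {0..1} (\<lambda>r. damp r a)"
  unfolding damp_def by (cases "a = 0") (auto intro!: continuous_on_powr'[OF continuous_on_id continuous_on_const])

lemma continuous_on_trig_dilate:
  "\<forall>l\<in>snd ` set xs. inner w l \<ge> 0 \<Longrightarrow> continuous_on {0..1} (\<lambda>r. trig (dilate w r xs) x)"
  by (induction xs) (auto intro!: continuous_intros continuous_on_damp)

lemma trig_dilate_zero:
  assumes "\<forall>l\<in>snd ` set xs. l = 0 \<or> inner w l > 0"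
  shows "trig (dilate w 0 xs) x = trig (dilate w 0 xs) y"
  using assms by (induction xs) (auto simp: damp_def e_fun_zero)

text \<open>
  The continuation of \<open>s \<mapsto> trig xs (x + s *\<^sub>R w)\<close> to complex \<open>s\<close>. On the positive imaginary axis it gives
  the dilations (\<open>trig_ext_imaginary\<close>).
\<close>
definition trig_ext :: "real ^ 'k \<Rightarrow> (complex \<times> (real ^ 'k)) list \<Rightarrow> real ^ 'k \<Rightarrow> complex \<Rightarrow> complex" where
  "trig_ext w xs x z = (\<Sum>(c, l)\<leftarrow>xs. c * e_fun l x * exp (\<i> * z * complex_of_real (inner w l)))"

lemma trig_ext_simps [simp]:
  "trig_ext w [] x z = 0"
  "trig_ext w ((c, l) # xs) x z = c * e_fun l x * exp (\<i> * z * complex_of_real (inner w l)) + trig_ext w xs x z"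
  by (simp_all add: trig_ext_def)

lemma holomorphic_trig_ext: "(\<lambda>z. trig_ext w xs x z) holomorphic_on A"
proof (induction xs)
  case (Cons a xs)
  obtain c l where a: "a = (c, l)" by (cases a)
  show ?case unfolding a trig_ext_simps by (intro holomorphic_intros Cons)
qed simp

lemma norm_trig_ext_le:
  assumes "\<forall>l\<in>snd ` set xs. inner w l \<ge> 0" "Im z \<ge> 0"
  shows "cmod (trig_ext w xs x z) \<le> (\<Sum>(c, l)\<leftarrow>xs. cmod c)"
  using assms(1)
proof (induction xs)
  case (Cons a xs)
  obtain c l where a: "a = (c, l)" by (cases a)
  have "cmod (c * e_fun l x * exp (\<i> * z * complex_of_real (inner w l))) \<le> cmod c"
    using Cons.prems assms(2) by (auto simp: a norm_mult intro!: mult_left_le)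
  then show ?case using Cons by (auto simp: a intro!: norm_triangle_mono)
qed simp

lemma trig_ext_of_real: "trig_ext w xs x (complex_of_real s) = trig xs (x + s *\<^sub>R w)"
proof (induction xs)
  case (Cons a xs)
  obtain c l where a: "a = (c, l)" by (cases a)
  have "e_fun l (s *\<^sub>R w) = exp (\<i> * complex_of_real s * complex_of_real (inner w l))"
    by (simp add: e_fun_def inner_commute mult.assoc)
  then show ?case using Cons by (simp add: a e_fun_shift)
qed simp

lemma trig_ext_imaginary:
  assumes "r > 0"
  shows "trig_ext w xs x (\<i> * complex_of_real (- ln r)) = trig (dilate w r xs) x"
proof (induction xs)
  case (Cons a xs)
  obtain c l where a: "a = (c, l)" by (cases a)
  have "\<i> * (\<i> * complex_of_real (- ln r)) * complex_of_real (inner w l) = complex_of_real (inner w l * ln r)"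
    by (simp add: algebra_simps)
  then have "exp (\<i> * (\<i> * complex_of_real (- ln r)) * complex_of_real (inner w l)) = complex_of_real (exp (inner w l * ln r))"
    by (simp only: exp_of_real)
  also have "exp (inner w l * ln r) = damp r (inner w l)" using assms by (simp add: damp_def powr_def)
  finally show ?case using Cons by (simp add: a)
qed simp

text \<open>
  In the application the sum is an entry of a matrix product and \<open>d\<close> the corresponding entry of the
  identity matrix. For \<open>r > 0\<close> the difference is the value at \<open>\<i> * - ln r\<close> of an entire function that is
  bounded on the upper half plane and bounded by \<open>\<epsilon>\<close> on the real line; \<open>r = 0\<close> follows by continuity.
\<close>
lemma dilate_product_sum_bound:
  fixes as bs :: "nat \<Rightarrow> (complex \<times> (real ^ 'k)) list"
  assumes as: "\<And>k. k < n \<Longrightarrow> \<forall>l\<in>snd ` set (as k). inner w l \<ge> 0"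
    and bs: "\<And>k. k < n \<Longrightarrow> \<forall>l\<in>snd ` set (bs k). inner w l \<ge> 0"
    and e: "\<epsilon> > 0" and near: "\<And>x. cmod ((\<Sum>k<n. trig (as k) x * trig (bs k) x) - d) \<le> \<epsilon>"
    and r: "r \<in> {0..1}"
  shows "cmod ((\<Sum>k<n. trig (dilate w r (as k)) x * trig (dilate w r (bs k)) x) - d) \<le> \<epsilon>"
proof -
  let ?f = "\<lambda>r. cmod ((\<Sum>k<n. trig (dilate w r (as k)) x * trig (dilate w r (bs k)) x) - d)"
  let ?h = "\<lambda>z. (\<Sum>k<n. trig_ext w (as k) x z * trig_ext w (bs k) x z) - d"
  have pos: "?f r \<le> \<epsilon>" if r: "0 < r" "r \<le> 1" for r
  proof -
    have "cmod (?h (\<i> * complex_of_real (- ln r))) \<le> \<epsilon>"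
    proof (rule norm_le_on_upper_halfplane[where h = ?h])
      show "?h holomorphic_on UNIV" by (intro holomorphic_intros holomorphic_trig_ext)
      show "cmod (?h z) \<le> (\<Sum>k<n. (\<Sum>(c, l)\<leftarrow>as k. cmod c) * (\<Sum>(c, l)\<leftarrow>bs k. cmod c)) + cmod d"
        if z: "Im z \<ge> 0" for z
      proof -
        have "cmod (\<Sum>k<n. trig_ext w (as k) x z * trig_ext w (bs k) x z)
            \<le> (\<Sum>k<n. (\<Sum>(c, l)\<leftarrow>as k. cmod c) * (\<Sum>(c, l)\<leftarrow>bs k. cmod c))"
        proof (rule sum_norm_le)
          fix k assume "k \<in> {..<n}"
          then have k: "k < n" by simp
          show "cmod (trig_ext w (as k) x z * trig_ext w (bs k) x z)
              \<le> (\<Sum>(c, l)\<leftarrow>as k. cmod c) * (\<Sum>(c, l)\<leftarrow>bs k. cmod c)"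
            unfolding norm_mult
            using norm_trig_ext_le[OF as[OF k] z, of x] norm_trig_ext_le[OF bs[OF k] z, of x]
            by (intro mult_mono') auto
        qed
        then show ?thesis by (intro norm_triangle_le_diff) simp
      qed
      show "cmod (?h (complex_of_real s)) \<le> \<epsilon>" for s unfolding trig_ext_of_real by (rule near)
      show "\<epsilon> > 0" by (rule e)
      show "Im (\<i> * complex_of_real (- ln r)) \<ge> 0" using r by simp
    qed
    then show ?thesis unfolding trig_ext_imaginary[OF r(1)] .
  qed
  have cont: "continuous_on {0..1} ?f"
    using as bs by (intro continuous_intros continuous_on_trig_dilate) auto
  have cl: "closure {0<..1 :: real} = {0..1}" by simp
  show ?thesis
    by (rule continuous_le_on_closure[of "{0<..1}" ?f r \<epsilon>]) (use cont pos r cl in auto)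
qed

text \<open>
  A bound for the change of a polynomial between the dilations by \<open>a\<close> and \<open>r\<close>. It does not involve the
  point \<open>x\<close>, so its continuity in \<open>r\<close> makes the path of dilations continuous in the supremum norm.
\<close>
definition dilate_dev :: "real ^ 'k \<Rightarrow> real \<Rightarrow> (complex \<times> (real ^ 'k)) list \<Rightarrow> real \<Rightarrow> real" where
  "dilate_dev w a xs r = (\<Sum>(c, l)\<leftarrow>xs. cmod c * \<bar>damp r (inner w l) - damp a (inner w l)\<bar>)"

lemma norm_dilate_diff_le: "cmod (trig (dilate w r xs) x - trig (dilate w a xs) x) \<le> dilate_dev w a xs r"
proof (induction xs)
  case (Cons y xs)
  obtain c l where y: "y = (c, l)" by (cases y)
  have "trig (dilate w r (y # xs)) x - trig (dilate w a (y # xs)) x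
      = c * complex_of_real (damp r (inner w l) - damp a (inner w l)) * e_fun l x
        + (trig (dilate w r xs) x - trig (dilate w a xs) x)"
    by (simp add: y algebra_simps)
  also have "cmod \<dots> \<le> cmod c * \<bar>damp r (inner w l) - damp a (inner w l)\<bar> + dilate_dev w a xs r"
    by (intro norm_triangle_mono Cons) (simp add: norm_mult del: of_real_diff)
  finally show ?case by (simp add: y dilate_dev_def)
qed (simp add: dilate_dev_def)

lemma dilate_dev_nonneg: "dilate_dev w a xs r \<ge> 0"
  unfolding dilate_dev_def by (intro sum_list_nonneg) auto

lemma dilate_dev_self: "dilate_dev w a xs a = 0"
  unfolding dilate_dev_def by (induction xs) auto

lemma continuous_on_dilate_dev:
  "\<forall>l\<in>snd ` set xs. inner w l \<ge> 0 \<Longrightarrow> continuous_on {0..1} (dilate_dev w a xs)"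
  unfolding dilate_dev_def
  by (induction xs) (auto intro!: continuous_intros continuous_on_damp)

section \<open>Completing right invertible matrices\<close>

text \<open>
  The nonzero elements of \<open>S\<close> form a convex set, because \<open>S\<close> is closed under sums and contains no line.
  The convex hull of \<open>F\<close> lies in it, hence is a compact convex set without the origin and can be separated
  from the origin. For all of \<open>S\<close> such a functional need not exist; finiteness of \<open>F\<close> is essential.
\<close>
lemma halfspace_positive_functional:
  fixes S :: "(real ^ 'k) set"
  assumes S: "halfspace S" and F: "finite F" "F \<subseteq> S - {0}"
  shows "\<exists>w. \<forall>l\<in>F. inner w l > 0"
proof -
  have add: "\<And>l u. l \<in> S \<Longrightarrow> u \<in> S \<Longrightarrow> l + u \<in> S" and scale: "\<And>l a. l \<in> S \<Longrightarrow> a \<ge> 0 \<Longrightarrow> a *\<^sub>R l \<in> S"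
    and pointed: "S \<inter> uminus ` S = {0}"
    using S by (auto simp: halfspace_def)
  have zero: "x = 0" if "x \<in> S" "y \<in> S" "x + y = 0" for x y
  proof -
    have "x = - y" using that(3) by (simp add: eq_neg_iff_add_eq_0)
    then have "x \<in> uminus ` S" using that(2) by blast
    then show ?thesis using that(1) pointed by blast
  qed
  have "convex (S - {0})"
  proof (rule convexI)
    fix x y :: "real ^ 'k" and u v :: real
    assume x: "x \<in> S - {0}" and y: "y \<in> S - {0}" and uv: "0 \<le> u" "0 \<le> v" "u + v = 1"
    have ux: "u *\<^sub>R x \<in> S" "v *\<^sub>R y \<in> S" using x y uv by (auto intro: scale)
    have "u *\<^sub>R x + v *\<^sub>R y \<noteq> 0"
    proof
      assume s: "u *\<^sub>R x + v *\<^sub>R y = 0"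
      have "u *\<^sub>R x = 0" by (rule zero[OF ux s])
      moreover have "v *\<^sub>R y = 0" using s unfolding \<open>u *\<^sub>R x = 0\<close> by simp
      ultimately show False using x y uv(3) by simp
    qed
    then show "u *\<^sub>R x + v *\<^sub>R y \<in> S - {0}" using add[OF ux] by simp
  qed
  then have "convex hull F \<subseteq> S - {0}" by (rule hull_minimal[OF F(2)])
  then have "0 \<notin> convex hull F" by blast
  moreover have "closed (convex hull F)"
    using F(1) by (intro compact_imp_closed compact_convex_hull finite_imp_compact)
  ultimately obtain a b where "b > 0" "\<forall>x\<in>convex hull F. inner a x > b"
    using separating_hyperplane_closed_0[OF convex_convex_hull] by blast
  then show ?thesis using hull_subset[of F convex] by (intro exI[of _ a]) fastforce
qed

lemma AP_mat_trig_approx: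
  assumes M: "M \<in> AP_mat D m n" and d: "\<delta> > 0"
  shows "\<exists>xs. \<forall>i<m. \<forall>j<n. snd ` set (xs i j) \<subseteq> D \<and> (\<forall>x. cmod (trig (xs i j) x - (M $$ (i, j)) x) \<le> \<delta>)"
proof -
  let ?P = "\<lambda>i j xs. snd ` set xs \<subseteq> D \<and> (\<forall>x. cmod (trig xs x - (M $$ (i, j)) x) \<le> \<delta>)"
  have "?P i j (SOME xs. ?P i j xs)" if ij: "i < m" "j < n" for i j
    using AP_on_trig_approx[OF AP_mat_entry[OF M ij] d] unfolding norm_minus_commute[of "trig _ _"] by (rule someI_ex)
  then show ?thesis by (intro exI[of _ "\<lambda>i j. SOME xs. ?P i j xs"]) blast
qed

text \<open>
  Approximations of \<open>B\<close> and \<open>R\<close> by other functions, later trigonometric polynomials, are still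
  approximately inverse to each other.
\<close>
lemma product_near_one:
  assumes D: "add_submonoid D" and B: "B \<in> AP_mat D m n" and R: "R \<in> AP_mat D n m" and BR: "B * R = 1\<^sub>m m"
    and e: "\<epsilon> > 0"
  shows "\<exists>\<delta>>0. \<forall>b r. (\<forall>i<m. \<forall>j<n. \<forall>x. cmod (b i j x - (B $$ (i, j)) x) \<le> \<delta>) \<longrightarrow>
     (\<forall>i<n. \<forall>j<m. \<forall>x. cmod (r i j x - (R $$ (i, j)) x) \<le> \<delta>) \<longrightarrow>
     (\<forall>i<m. \<forall>j<m. \<forall>x. cmod ((\<Sum>k<n. b i k x * r k j x) - 1\<^sub>m m $$ (i, j)) \<le> \<epsilon>)"
proof -
  obtain CB where CB: "CB > 0" "\<And>i j x. i < m \<Longrightarrow> j < n \<Longrightarrow> cmod ((B $$ (i, j)) x) \<le> CB"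
    using AP_mat_bounded[OF B] by blast
  obtain CR where CR: "CR > 0" "\<And>i j x. i < n \<Longrightarrow> j < m \<Longrightarrow> cmod ((R $$ (i, j)) x) \<le> CR"
    using AP_mat_bounded[OF R] by blast
  define N where "N = real n * (CR + 1 + CB) + 1"
  have N: "N > 0" unfolding N_def using CB CR by (intro add_nonneg_pos) auto
  define \<delta> where "\<delta> = min 1 (\<epsilon> / N)"
  have d: "\<delta> > 0" "\<delta> \<le> 1" "N * \<delta> \<le> \<epsilon>"
    using e N by (auto simp: \<delta>_def min_def field_simps)
  have main: "cmod ((\<Sum>k<n. b i k x * r k j x) - 1\<^sub>m m $$ (i, j)) \<le> \<epsilon>"
    if b: "\<forall>i<m. \<forall>j<n. \<forall>x. cmod (b i j x - (B $$ (i, j)) x) \<le> \<delta>"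
    and r: "\<forall>i<n. \<forall>j<m. \<forall>x. cmod (r i j x - (R $$ (i, j)) x) \<le> \<delta>"
    and ij: "i < m" "j < m" for b r i j x
  proof -
    have "(1\<^sub>m m $$ (i, j) :: complex) = ((B * R) $$ (i, j)) x" unfolding BR using ij by simp
    also have "\<dots> = (\<Sum>k<n. (B $$ (i, k)) x * (R $$ (k, j)) x)"
      by (rule mat_mult_entry_apply[OF AP_mat_carrier[OF B] AP_mat_carrier[OF R] ij])
    finally have "(\<Sum>k<n. b i k x * r k j x) - 1\<^sub>m m $$ (i, j)
        = (\<Sum>k<n. b i k x * r k j x - (B $$ (i, k)) x * (R $$ (k, j)) x)"
      by (simp add: sum_subtractf)
    also have "cmod \<dots> \<le> (\<Sum>k<n. \<delta> * (CR + 1) + CB * \<delta>)"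
    proof (rule sum_norm_le)
      fix k assume "k \<in> {..<n}"
      then have k: "k < n" by simp
      let ?b = "b i k x" and ?r = "r k j x" and ?B = "(B $$ (i, k)) x" and ?R = "(R $$ (k, j)) x"
      have 1: "cmod (?b - ?B) \<le> \<delta>" "cmod (?r - ?R) \<le> \<delta>" "cmod ?B \<le> CB" "cmod ?R \<le> CR"
        using b r CB CR ij k by auto
      have "cmod ?r \<le> CR + 1" using norm_triangle_ineq[of "?r - ?R" ?R] 1 d by simp
      then have "cmod ((?b - ?B) * ?r) \<le> \<delta> * (CR + 1)"
        unfolding norm_mult using 1 d by (intro mult_mono) auto
      moreover have "cmod (?B * (?r - ?R)) \<le> CB * \<delta>"
        unfolding norm_mult using 1 CB by (intro mult_mono) auto
      ultimately have "cmod ((?b - ?B) * ?r + ?B * (?r - ?R)) \<le> \<delta> * (CR + 1) + CB * \<delta>"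
        by (rule norm_triangle_mono)
      also have "(?b - ?B) * ?r + ?B * (?r - ?R) = ?b * ?r - ?B * ?R" by (simp add: algebra_simps)
      finally show "cmod (?b * ?r - ?B * ?R) \<le> \<delta> * (CR + 1) + CB * \<delta>" .
    qed
    also have "\<dots> = (N - 1) * \<delta>" by (simp add: N_def algebra_simps)
    also have "\<dots> \<le> N * \<delta>" using d(1) by (intro mult_right_mono) auto
    finally show ?thesis using d(3) by simp
  qed
  show ?thesis by (rule exI[of _ \<delta>]) (use d(1) main in blast)
qed

text \<open>
  The algebra of functions with spectrum in \<open>D\<close> is a Hermite ring. The path \<open>P r\<close> joins trigonometric
  approximations of \<open>B\<close>, at \<open>r = 1\<close>, to a constant matrix, at \<open>r = 0\<close>, through matrices that stay right
  invertible; column equivalence classes are open along it, and \<open>{0..1}\<close> is connected.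
\<close>
theorem right_invertible_completable:
  fixes S D :: "(real ^ 'k) set"
  assumes S: "halfspace S" and DS: "D \<subseteq> S" and D: "add_submonoid D"
    and B: "B \<in> AP_mat D m n" and R: "R \<in> AP_mat D n m" and BR: "B * R = 1\<^sub>m m" and mn: "m \<le> n"
  shows "completable D m n B"
proof -
  obtain \<delta>1 where d1: "\<delta>1 > 0" and near_B: "\<And>B'. B' \<in> AP_mat D m n
      \<Longrightarrow> \<forall>i<m. \<forall>j<n. \<forall>x. cmod ((B' $$ (i, j)) x - (B $$ (i, j)) x) \<le> \<delta>1 \<Longrightarrow> col_equiv D n B B'"
    using col_equiv_near[OF D B R BR] by (elim exE conjE) (rule that, assumption, rule mp, rule bspec)
  obtain \<epsilon> where e: "\<epsilon> > 0" and inv: "\<And>X. X \<in> AP_mat D m m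
     \<Longrightarrow> \<forall>i<m. \<forall>j<m. \<forall>x. cmod ((X $$ (i, j)) x - 1\<^sub>m m $$ (i, j)) \<le> \<epsilon> \<Longrightarrow> invertible_over D m X"
    using invertible_over_near_one[OF D, of m] by (elim exE conjE) (rule that, assumption, rule mp, rule bspec)
  obtain \<delta>2 where d2: "\<delta>2 > 0" and prod: "\<And>b r. \<forall>i<m. \<forall>j<n. \<forall>x. cmod (b i j x - (B $$ (i, j)) x) \<le> \<delta>2 \<Longrightarrow>
     \<forall>i<n. \<forall>j<m. \<forall>x. cmod (r i j x - (R $$ (i, j)) x) \<le> \<delta>2 \<Longrightarrow>
     \<forall>i<m. \<forall>j<m. \<forall>x. cmod ((\<Sum>k<n. b i k x * r k j x) - 1\<^sub>m m $$ (i, j)) \<le> \<epsilon>"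
    using product_near_one[OF D B R BR e] by (elim exE conjE) (rule that, assumption, rule mp, rule mp, elim allE)
  define \<delta> where "\<delta> = min \<delta>1 \<delta>2"
  have d: "\<delta> > 0" "\<delta> \<le> \<delta>1" "\<delta> \<le> \<delta>2" using d1 d2 by (auto simp: \<delta>_def)
  obtain xs where xs: "\<And>i j. i < m \<Longrightarrow> j < n \<Longrightarrow> snd ` set (xs i j) \<subseteq> D"
      "\<And>i j x. i < m \<Longrightarrow> j < n \<Longrightarrow> cmod (trig (xs i j) x - (B $$ (i, j)) x) \<le> \<delta>"
    using AP_mat_trig_approx[OF B d(1)] by blast
  obtain ys where ys: "\<And>i j. i < n \<Longrightarrow> j < m \<Longrightarrow> snd ` set (ys i j) \<subseteq> D"
      "\<And>i j x. i < n \<Longrightarrow> j < m \<Longrightarrow> cmod (trig (ys i j) x - (R $$ (i, j)) x) \<le> \<delta>"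
    using AP_mat_trig_approx[OF R d(1)] by blast
  have near: "\<forall>i<m. \<forall>j<m. \<forall>x. cmod ((\<Sum>k<n. trig (xs i k) x * trig (ys k j) x) - 1\<^sub>m m $$ (i, j)) \<le> \<epsilon>"
    using prod[of "\<lambda>i j. trig (xs i j)" "\<lambda>i j. trig (ys i j)"] xs(2) ys(2) d(3) order_trans by blast

  define F where "F = (\<Union>i<m. \<Union>j<n. snd ` set (xs i j) \<union> snd ` set (ys j i)) - {0}"
  have "finite F" by (auto simp: F_def)
  moreover have "F \<subseteq> S - {0}" using xs(1) ys(1) DS by (fastforce simp: F_def)
  ultimately obtain w where w: "\<forall>l\<in>F. inner w l > 0" using halfspace_positive_functional[OF S] by blast
  have wF: "l = 0 \<or> inner w l > 0"
    if "i < m" "j < n" "l \<in> snd ` set (xs i j) \<union> snd ` set (ys j i)" for i j l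
  proof (cases "l = 0")
    case False
    then have "l \<in> F" unfolding F_def using that by blast
    then show ?thesis using w by blast
  qed simp
  have wx: "\<forall>l\<in>snd ` set (xs i j). l = 0 \<or> inner w l > 0" if "i < m" "j < n" for i j
    using wF[OF that] by blast
  have wy: "\<forall>l\<in>snd ` set (ys j i). l = 0 \<or> inner w l > 0" if "i < m" "j < n" for i j
    using wF[OF that] by blast
  have wx': "\<forall>l\<in>snd ` set (xs i j). inner w l \<ge> 0" if "i < m" "j < n" for i j
    using wx[OF that] by (auto intro: less_imp_le)
  have wy': "\<forall>l\<in>snd ` set (ys j i). inner w l \<ge> 0" if "i < m" "j < n" for i j
    using wy[OF that] by (auto intro: less_imp_le)

  define P where "P r = mat m n (\<lambda>(i, j). trig (dilate w r (xs i j)))" for r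
  define Q where "Q r = mat n m (\<lambda>(i, j). trig (dilate w r (ys i j)))" for r
  have P: "P r \<in> AP_mat D m n" and Q: "Q r \<in> AP_mat D n m" for r
    using trig_AP_on[of "dilate w r (xs _ _)" D, unfolded snd_set_dilate, OF xs(1)]
      trig_AP_on[of "dilate w r (ys _ _)" D, unfolded snd_set_dilate, OF ys(1)]
    by (simp_all add: AP_mat_iff P_def Q_def)
  \<comment> \<open>The product of the dilated matrices is close to the identity, hence invertible; its inverse corrects
    \<open>Q r\<close> to an exact right inverse.\<close>
  have right_inv: "\<exists>Q'\<in>AP_mat D n m. P r * Q' = 1\<^sub>m m" if r: "r \<in> {0..1}" for r
  proof -
    have "cmod (((P r * Q r) $$ (i, j)) x - 1\<^sub>m m $$ (i, j)) \<le> \<epsilon>" if ij: "i < m" "j < m" for i j x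
    proof -
      have "((P r * Q r) $$ (i, j)) x = (\<Sum>k<n. (P r $$ (i, k)) x * (Q r $$ (k, j)) x)"
        by (rule mat_mult_entry_apply[OF AP_mat_carrier[OF P] AP_mat_carrier[OF Q] ij])
      also have "\<dots> = (\<Sum>k<n. trig (dilate w r (xs i k)) x * trig (dilate w r (ys k j)) x)"
        using ij by (intro sum.cong) (auto simp: P_def Q_def)
      finally show ?thesis
        using dilate_product_sum_bound[of n "xs i" w "\<lambda>k. ys k j", OF wx'[OF ij(1)] wy'[OF ij(2)] e _ r]
          near[rule_format, OF ij] by (simp only:)
    qed
    then have "invertible_over D m (P r * Q r)" by (intro inv AP_mat_mult[OF D P Q]) blast
    then obtain V where V: "V \<in> AP_mat D m m" "(P r * Q r) * V = 1\<^sub>m m" by (auto simp: invertible_over_def)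
    then have "P r * (Q r * V) = 1\<^sub>m m"
      using assoc_mult_mat[OF AP_mat_carrier[OF P] AP_mat_carrier[OF Q] AP_mat_carrier[OF V(1)]] by simp
    then show ?thesis using AP_mat_mult[OF D Q V(1)] by blast
  qed

  have path: "col_equiv D n (P 0) (P 1)"
  proof (rule connected_equivalence_relation[where S = "{0..1 :: real}" and R = "\<lambda>r s. col_equiv D n (P r) (P s)"])
    fix a :: real assume a: "a \<in> {0..1}"
    obtain Q' where Q': "Q' \<in> AP_mat D n m" "P a * Q' = 1\<^sub>m m" using right_inv[OF a] by blast
    obtain \<eta> where eta: "\<eta> > 0" and stable: "\<And>B'. B' \<in> AP_mat D m n
      \<Longrightarrow> \<forall>i<m. \<forall>j<n. \<forall>x. cmod ((B' $$ (i, j)) x - (P a $$ (i, j)) x) \<le> \<eta> \<Longrightarrow> col_equiv D n (P a) B'"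
      using col_equiv_near[OF D P Q'] by (elim exE conjE) (rule that, assumption, rule mp, rule bspec)
    define \<phi> where "\<phi> r = (\<Sum>(i, j)\<in>{..<m} \<times> {..<n}. dilate_dev w a (xs i j) r)" for r
    have cont: "continuous_on {0..1} \<phi>"
      unfolding \<phi>_def case_prod_unfold
      by (intro continuous_on_sum continuous_on_dilate_dev wx') auto
    let ?T = "{0..1} \<inter> \<phi> -` {..<\<eta>}"
    have "openin (top_of_set {0..1}) ?T" by (rule continuous_openin_preimage_gen[OF cont open_lessThan])
    moreover have "a \<in> ?T" using a eta by (simp add: \<phi>_def dilate_dev_self)
    moreover have "col_equiv D n (P a) (P r)" if r: "r \<in> ?T" for r
    proof (rule stable[OF P], intro allI impI)
      fix i j x assume ij: "i < m" "j < n"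
      have "cmod (trig (dilate w r (xs i j)) x - trig (dilate w a (xs i j)) x) \<le> dilate_dev w a (xs i j) r"
        by (rule norm_dilate_diff_le)
      also have "\<dots> = (\<lambda>(i, j). dilate_dev w a (xs i j) r) (i, j)" by simp
      also have "\<dots> \<le> \<phi> r"
        unfolding \<phi>_def using ij by (intro member_le_sum) (auto simp: dilate_dev_nonneg)
      also have "\<dots> \<le> \<eta>" using r by simp
      finally show "cmod ((P r $$ (i, j)) x - (P a $$ (i, j)) x) \<le> \<eta>" using ij by (simp add: P_def)
    qed
    ultimately show "\<exists>T. openin (top_of_set {0..1}) T \<and> a \<in> T \<and> (\<forall>r\<in>T. col_equiv D n (P a) (P r))" by blast
  next
    show "col_equiv D n (P s) (P r)" if "col_equiv D n (P r) (P s)" for r s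
      by (rule col_equiv_sym[OF AP_mat_carrier[OF P] that])
    show "col_equiv D n (P r) (P t)" if "col_equiv D n (P r) (P s)" "col_equiv D n (P s) (P t)" for r s t
      by (rule col_equiv_trans[OF D AP_mat_carrier[OF P] that])
  qed simp_all

  \<comment> \<open>At \<open>r = 0\<close> only the terms with exponent zero survive, so the value at one point determines \<open>P 0\<close>.\<close>
  define K where "K = mat m n (\<lambda>(i, j). trig (dilate w 0 (xs i j)) 0)"
  have P0: "P 0 = map_mat (\<lambda>c x. c) K"
  proof (rule eq_matI)
    fix i j assume "i < dim_row (map_mat (\<lambda>c (x :: real ^ 'k). c) K)" "j < dim_col (map_mat (\<lambda>c (x :: real ^ 'k). c) K)"
    then have ij: "i < m" "j < n" by (auto simp: K_def)
    have "trig (dilate w 0 (xs i j)) = (\<lambda>x. trig (dilate w 0 (xs i j)) 0)"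
      by (rule ext) (rule trig_dilate_zero[OF wx[OF ij]])
    then show "P 0 $$ (i, j) = map_mat (\<lambda>c x. c) K $$ (i, j)" using ij by (simp add: P_def K_def)
  qed (auto simp: P_def K_def)
  obtain Q' where Q': "Q' \<in> AP_mat D n m" "P 0 * Q' = 1\<^sub>m m" using right_inv[of 0] by auto
  interpret ev: comm_ring_hom "\<lambda>f :: real ^ 'k \<Rightarrow> complex. f 0" by standard auto
  let ?ev = "map_mat (\<lambda>f :: real ^ 'k \<Rightarrow> complex. f 0)"
  have Kev: "?ev (P 0) = K" unfolding P0 by (intro eq_matI) auto
  have "K * ?ev Q' = ?ev (P 0 * Q')"
    unfolding ev.mat_hom_mult[OF AP_mat_carrier[OF P] AP_mat_carrier[OF Q'(1)]] Kev ..
  also have "\<dots> = 1\<^sub>m m" unfolding Q'(2) by (rule ev.mat_hom_one)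
  finally have "completable D m n (P 0)"
    unfolding P0 using AP_mat_carrier[OF Q'(1)] mn by (intro completable_constant[OF D]) (auto simp: K_def)
  then have "completable D m n (P 1)" by (rule completable_col_equiv[OF D P path])
  moreover have "col_equiv D n B (P 1)"
    by (rule near_B[OF P]) (use xs(2) d(2) in \<open>auto simp: P_def dilate_one intro: order_trans\<close>)
  ultimately show ?thesis
    using completable_col_equiv[OF D P] col_equiv_sym[OF AP_mat_carrier[OF B]] by blast
qed

section \<open>The augmentation theorem\<close>

text \<open>
  The part of a factorization that does not mention the order of the indices, with separate spectral
  sets for the two outer factors. Transposition exchanges \<open>P\<close> and \<open>Q\<close> and keeps the list of indices; the
  ordering condition would not survive replacing \<open>S\<close> by \<open>- S\<close>.
\<close>
definition AP_splits ::
  "(real ^ 'k) set \<Rightarrow> (real ^ 'k) set \<Rightarrow> nat \<Rightarrow> nat \<Rightarrow> (real ^ 'k \<Rightarrow> complex) mat \<Rightarrow> (real ^ 'k) list \<Rightarrow> bool" where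
  "AP_splits P Q m n G ls \<longleftrightarrow> (let p = max m n in \<exists>Gp Gm.
     Gp \<in> AP_mat P m p \<and> (\<exists>R\<in>AP_mat P p m. Gp * R = 1\<^sub>m m) \<and>
     Gm \<in> AP_mat Q p n \<and> (\<exists>L\<in>AP_mat Q n p. L * Gm = 1\<^sub>m n) \<and>
     G = Gp * mat_diag p (\<lambda>j. e_fun (ls ! j)) * Gm)"

lemma AP_factorable_with_iff_splits:
  "AP_factorable_with S \<Sigma> m n G ls \<longleftrightarrow>
     length ls = max m n \<and> set ls \<subseteq> \<Sigma> \<and> (\<forall>j. 1 \<le> j \<and> j < max m n \<longrightarrow> ls ! j - ls ! (j - 1) \<in> S) \<and>
     AP_splits (\<Sigma> \<inter> S) (\<Sigma> \<inter> uminus ` S) m n G ls"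
  unfolding AP_factorable_with_def is_AP_factorization_def AP_splits_def Let_def by blast

lemma transpose_mat_diag: "transpose_mat (mat_diag p f) = mat_diag p f"
  by (intro eq_matI) (auto simp: mat_diag_def)

lemma AP_splits_transpose:
  assumes "AP_splits P Q m n G ls"
  shows "AP_splits Q P n m (transpose_mat G) ls"
proof -
  let ?p = "max m n"
  let ?D = "mat_diag ?p (\<lambda>j. e_fun (ls ! j))"
  obtain Gp R Gm L where
    G: "Gp \<in> AP_mat P m ?p" "R \<in> AP_mat P ?p m" "Gp * R = 1\<^sub>m m"
      "Gm \<in> AP_mat Q ?p n" "L \<in> AP_mat Q n ?p" "L * Gm = 1\<^sub>m n" "G = Gp * ?D * Gm"
    using assms unfolding AP_splits_def Let_def by blast
  note c = AP_mat_carrier[OF G(1)] AP_mat_carrier[OF G(2)] AP_mat_carrier[OF G(4)] AP_mat_carrier[OF G(5)]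
  have D: "?D \<in> carrier_mat ?p ?p" by simp
  have "transpose_mat G = transpose_mat Gm * (?D * transpose_mat Gp)"
    unfolding G(7) using c D
    by (simp only: transpose_mult[OF mult_carrier_mat[OF c(1) D] c(3)] transpose_mult[OF c(1) D] transpose_mat_diag)
  also have "\<dots> = transpose_mat Gm * ?D * transpose_mat Gp"
    using c by (intro assoc_mult_mat[symmetric]) auto
  finally have "transpose_mat G = transpose_mat Gm * ?D * transpose_mat Gp" .
  moreover have "transpose_mat Gm * transpose_mat L = 1\<^sub>m n" "transpose_mat R * transpose_mat Gp = 1\<^sub>m m"
    using transpose_mult[OF c(4) c(3)] transpose_mult[OF c(1) c(2)] G(3,6) by simp_all
  ultimately show ?thesis
    using G(1,2,4,5)[THEN AP_mat_transpose] unfolding AP_splits_def Let_def max.commute[of n m] by blast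
qed

lemma AP_splits_transpose_iff:
  "AP_splits P Q m n G ls \<longleftrightarrow> AP_splits Q P n m (transpose_mat G) ls"
  using AP_splits_transpose[of P Q m n G ls] AP_splits_transpose[of Q P n m "transpose_mat G" ls] by auto

lemma AP_mat_diag_e_fun:
  assumes "add_submonoid \<Sigma>" "length ls = p" "set ls \<subseteq> \<Sigma>"
  shows "mat_diag p (\<lambda>j. e_fun (ls ! j)) \<in> AP_mat \<Sigma> p p"
  using assms AP_on_0[OF assms(1)] by (auto simp: AP_mat_iff mat_diag_def intro!: AP_on_e_fun)

text \<open>
  From left to right the rows that complete \<open>Gp\<close> yield \<open>H\<close>; from right to left the first \<open>m\<close> rows of the
  outer left factor are kept, with the first \<open>m\<close> columns of its right inverse.
\<close>
lemma AP_splits_augment_rows: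
  fixes S \<Sigma> P Q :: "(real ^ 'k) set"
  assumes S: "halfspace S" and PS: "P \<subseteq> S" and mon: "add_submonoid P" "add_submonoid \<Sigma>"
    and sub: "P \<subseteq> \<Sigma>" "Q \<subseteq> \<Sigma>" and G: "G \<in> AP_mat \<Sigma> m n" and mn: "m < n"
    and ls: "length ls = n" "set ls \<subseteq> \<Sigma>"
  shows "AP_splits P Q m n G ls \<longleftrightarrow> (\<exists>H\<in>AP_mat \<Sigma> (n - m) n. AP_splits P Q n n (G @\<^sub>r H) ls)"
proof
  let ?D = "mat_diag n (\<lambda>j. e_fun (ls ! j))"
  have p: "max m n = n" using mn by simp
  have D: "?D \<in> carrier_mat n n" by simp
  {
    assume "AP_splits P Q m n G ls"
    then obtain Gp R Gm L where
      F: "Gp \<in> AP_mat P m n" "R \<in> AP_mat P n m" "Gp * R = 1\<^sub>m m"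
        "Gm \<in> AP_mat Q n n" "L \<in> AP_mat Q n n" "L * Gm = 1\<^sub>m n" "G = Gp * ?D * Gm"
      unfolding AP_splits_def Let_def p by blast
    obtain C V where C: "C \<in> AP_mat P (n - m) n" and V: "V \<in> AP_mat P n n" "(Gp @\<^sub>r C) * V = 1\<^sub>m n"
      using right_invertible_completable[OF S PS mon(1) F(1-3)] mn
      unfolding completable_def invertible_over_def by auto
    have Gp': "Gp @\<^sub>r C \<in> AP_mat P n n" using AP_mat_append_rows[OF F(1) C] mn by simp
    note c = AP_mat_carrier[OF F(1)] AP_mat_carrier[OF C] AP_mat_carrier[OF F(4)]
    have "(Gp @\<^sub>r C) * ?D * Gm = (Gp * ?D * Gm) @\<^sub>r (C * ?D * Gm)"
      by (simp only: append_rows_mult[OF c(1,2) D] append_rows_mult[OF mult_carrier_mat[OF c(1) D] mult_carrier_mat[OF c(2) D] c(3)])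
    then have "G @\<^sub>r (C * ?D * Gm) = (Gp @\<^sub>r C) * ?D * Gm" using F(7) by simp
    moreover have "C * ?D * Gm \<in> AP_mat \<Sigma> (n - m) n"
      by (rule AP_mat_mult[OF mon(2) AP_mat_mult[OF mon(2) subsetD[OF AP_mat_mono[OF sub(1)] C]
              AP_mat_diag_e_fun[OF mon(2) ls]] subsetD[OF AP_mat_mono[OF sub(2)] F(4)]])
    ultimately show "\<exists>H\<in>AP_mat \<Sigma> (n - m) n. AP_splits P Q n n (G @\<^sub>r H) ls"
      using Gp' V F(4-6) unfolding AP_splits_def Let_def max.idem by blast
  }
  {
    assume "\<exists>H\<in>AP_mat \<Sigma> (n - m) n. AP_splits P Q n n (G @\<^sub>r H) ls"
    then obtain H Gp R Gm L where H: "H \<in> AP_mat \<Sigma> (n - m) n"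
      and F: "Gp \<in> AP_mat P n n" "R \<in> AP_mat P n n" "Gp * R = 1\<^sub>m n"
        "Gm \<in> AP_mat Q n n" "L \<in> AP_mat Q n n" "L * Gm = 1\<^sub>m n" "G @\<^sub>r H = Gp * ?D * Gm"
      unfolding AP_splits_def Let_def max.idem by blast
    note c = AP_mat_carrier[OF F(1)] AP_mat_carrier[OF F(2)] AP_mat_carrier[OF F(4)]
    define T where "T = mat m n (\<lambda>(i, j). Gp $$ (i, j))"
    define B where "B = mat (n - m) n (\<lambda>(i, j). Gp $$ (i + m, j))"
    define R' where "R' = mat n m (\<lambda>(i, j). R $$ (i, j))"
    have TB: "T \<in> carrier_mat m n" "B \<in> carrier_mat (n - m) n" by (simp_all add: T_def B_def)
    have Gp: "Gp = T @\<^sub>r B"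
      using c TB mn by (intro eq_matI) (auto simp: append_rows_def T_def B_def)
    have T: "T \<in> AP_mat P m n" using F(1) mn by (auto simp: AP_mat_iff T_def)
    have R': "R' \<in> AP_mat P n m" using F(2) mn by (auto simp: AP_mat_iff R'_def)
    have TR': "T * R' = 1\<^sub>m m"
    proof (rule eq_matI)
      fix i j assume "i < dim_row (1\<^sub>m m :: (real ^ 'k \<Rightarrow> complex) mat)" "j < dim_col (1\<^sub>m m :: (real ^ 'k \<Rightarrow> complex) mat)"
      then have ij: "i < m" "j < m" by auto
      have "(T * R') $$ (i, j) = (Gp * R) $$ (i, j)"
        using ij mn c by (auto simp: T_def R'_def scalar_prod_def)
      then show "(T * R') $$ (i, j) = 1\<^sub>m m $$ (i, j)" using ij mn by (simp add: F(3))
    qed (auto simp: T_def R'_def)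
    have "G @\<^sub>r H = (T * ?D * Gm) @\<^sub>r (B * ?D * Gm)"
      unfolding F(7) Gp
      by (simp only: append_rows_mult[OF TB D] append_rows_mult[OF mult_carrier_mat[OF TB(1) D] mult_carrier_mat[OF TB(2) D] c(3)])
    moreover have TDG: "T * ?D * Gm \<in> carrier_mat m n" "B * ?D * Gm \<in> carrier_mat (n - m) n" using TB c by auto
    ultimately have "G = T * ?D * Gm"
    proof (intro eq_matI)
      fix i j assume ij: "i < dim_row (T * ?D * Gm)" "j < dim_col (T * ?D * Gm)"
      then have ij: "i < m" "j < n" using TDG(1) by auto
      have "G $$ (i, j) = (G @\<^sub>r H) $$ (i, j)"
        using ij append_rows_index[OF AP_mat_carrier[OF G] AP_mat_carrier[OF H], of i j] by simp
      also have "\<dots> = (T * ?D * Gm) $$ (i, j)"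
        unfolding \<open>G @\<^sub>r H = (T * ?D * Gm) @\<^sub>r (B * ?D * Gm)\<close>
        using ij append_rows_index[OF TDG, of i j] by simp
      finally show "G $$ (i, j) = (T * ?D * Gm) $$ (i, j)" .
    qed (use AP_mat_carrier[OF G] TDG(1) in auto)
    then show "AP_splits P Q m n G ls"
      using T R' TR' F(4-6) unfolding AP_splits_def Let_def p by blast
  }
qed

lemma transpose_append_cols:
  assumes "A \<in> carrier_mat m n" "B \<in> carrier_mat m k"
  shows "transpose_mat (append_cols A B) = transpose_mat A @\<^sub>r transpose_mat B"
  using assms by (intro eq_matI) (auto simp: append_cols_def append_rows_def)

text \<open>
  By transposition the right factor takes the place of the left one, so it is the halfspace containing
  the spectra of the right factor that matters.
\<close>
lemma AP_splits_augment_cols: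
  fixes S \<Sigma> P Q :: "(real ^ 'k) set"
  assumes S: "halfspace S" and QS: "Q \<subseteq> S" and mon: "add_submonoid Q" "add_submonoid \<Sigma>"
    and sub: "P \<subseteq> \<Sigma>" "Q \<subseteq> \<Sigma>" and G: "G \<in> AP_mat \<Sigma> m n" and nm: "n < m"
    and ls: "length ls = m" "set ls \<subseteq> \<Sigma>"
  shows "AP_splits P Q m n G ls \<longleftrightarrow> (\<exists>H\<in>AP_mat \<Sigma> m (m - n). AP_splits P Q m m (append_cols G H) ls)"
proof -
  have "AP_splits P Q m n G ls
      \<longleftrightarrow> (\<exists>H\<in>AP_mat \<Sigma> (m - n) m. AP_splits Q P m m (transpose_mat G @\<^sub>r H) ls)"
    unfolding AP_splits_transpose_iff[of P Q m n]
    by (rule AP_splits_augment_rows[OF S QS mon sub(2,1) AP_mat_transpose[OF G] nm ls])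
  also have "\<dots> \<longleftrightarrow> (\<exists>H\<in>AP_mat \<Sigma> m (m - n). AP_splits Q P m m (transpose_mat G @\<^sub>r transpose_mat H) ls)"
    using AP_mat_transpose transpose_transpose by metis
  also have "\<dots> \<longleftrightarrow> (\<exists>H\<in>AP_mat \<Sigma> m (m - n). AP_splits P Q m m (append_cols G H) ls)"
    unfolding AP_splits_transpose_iff[of P Q m m]
    using transpose_append_cols[OF AP_mat_carrier[OF G] AP_mat_carrier] by (intro bex_cong refl) metis
  finally show ?thesis .
qed

lemma halfspace_uminus:
  assumes "halfspace (S :: (real ^ 'k) set)" shows "halfspace (uminus ` S)"
proof -
  have neg: "uminus ` uminus ` S = S" by (simp add: image_image)
  have add: "- l + - u \<in> uminus ` S" if "l \<in> S" "u \<in> S" for l u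
    using assms that by (auto simp: halfspace_def intro!: image_eqI[of _ _ "l + u"])
  have scale: "a *\<^sub>R - l \<in> uminus ` S" if "l \<in> S" "a \<ge> 0" for l a
    using assms that by (auto simp: halfspace_def)
  show ?thesis
    using assms add scale unfolding halfspace_def neg by (auto simp: Un_commute Int_commute)
qed

theorem theorem4p2:
  fixes S \<Sigma> :: "(real ^ 'k) set"
    and G :: "(real ^ 'k \<Rightarrow> complex) mat"
    and m n :: nat
  assumes "halfspace S"
    and "add_subgroup \<Sigma>"
    and "G \<in> AP_mat \<Sigma> m n"
  shows
    "(m < n \<longrightarrow>
        (\<forall>ls. AP_factorable_with S \<Sigma> m n G ls \<longleftrightarrow>
           (\<exists>H \<in> AP_mat \<Sigma> (n - m) n. AP_factorable_with S \<Sigma> n n (append_rows G H) ls)) \<and>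
        (canonically_AP_factorable S \<Sigma> m n G \<longleftrightarrow>
           (\<exists>H \<in> AP_mat \<Sigma> (n - m) n. canonically_AP_factorable S \<Sigma> n n (append_rows G H)))) \<and>
     (m > n \<longrightarrow>
        (\<forall>ls. AP_factorable_with S \<Sigma> m n G ls \<longleftrightarrow>
           (\<exists>H \<in> AP_mat \<Sigma> m (m - n). AP_factorable_with S \<Sigma> m m (append_cols G H) ls)) \<and>
        (canonically_AP_factorable S \<Sigma> m n G \<longleftrightarrow>
           (\<exists>H \<in> AP_mat \<Sigma> m (m - n). canonically_AP_factorable S \<Sigma> m m (append_cols G H))))"
proof -
  have S': "halfspace (uminus ` S)" using assms(1) by (rule halfspace_uminus)
  have \<Sigma>: "add_submonoid \<Sigma>" using assms(2) by (simp add: add_subgroup_def add_submonoid_def)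
  have mon: "add_submonoid (\<Sigma> \<inter> T)" if "halfspace T" for T
    using that \<Sigma> by (auto simp: add_submonoid_def halfspace_def)
  have rows: "AP_factorable_with S \<Sigma> m n G ls \<longleftrightarrow>
      (\<exists>H \<in> AP_mat \<Sigma> (n - m) n. AP_factorable_with S \<Sigma> n n (append_rows G H) ls)" if "m < n" for ls
    using AP_splits_augment_rows[OF assms(1) _ mon[OF assms(1)] \<Sigma> _ _ assms(3) that, of "\<Sigma> \<inter> uminus ` S" ls] that
    unfolding AP_factorable_with_iff_splits by auto
  have cols: "AP_factorable_with S \<Sigma> m n G ls \<longleftrightarrow>
      (\<exists>H \<in> AP_mat \<Sigma> m (m - n). AP_factorable_with S \<Sigma> m m (append_cols G H) ls)" if "m > n" for ls
    using AP_splits_augment_cols[OF S' _ mon[OF S'] \<Sigma> _ _ assms(3) that, of "\<Sigma> \<inter> S" ls] that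
    unfolding AP_factorable_with_iff_splits by auto
  show ?thesis
    unfolding canonically_AP_factorable_def using rows cols by blast
qed

end
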